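(* For every integer $m \geq 1$, let $G_m$ be the group with generators $a_1, \ldots, a_m, b_1, b_2, c_1, \ldots, c_m$ and defining relations \begin{itemize} \item $a_i a_j = a_j a_i$ for all $1 \leq i,j \leq m$; \item $b_1 b_2 = b_2 b_1$; \item $b_1 a_i = a_i b_1 c_i$ for $i = 1, \ldots, m$; \item $b_2 a_i = a_i b_2 c_{i+1}^{-1}$ for $i = 1, \ldots, m-1$; \item $b_2 a_m = a_m b_2$; \item $c_i c_j = c_j c_i$ and $a_i c_j = c_j a_i$ for all $1 \leq i,j \leq m$, and $b_i c_j = c_j b_i$ for all $i \in \{1,2\}$ and $1 \leq j \leq m$. \end{itemize} Then the conjugator length function of $G_m$ satisfies $\mathrm{CL}(n) \simeq n^{m+1}$.
   Context: Let $G$ be a group with a fixed finite generating set $S$. Words are finite words in the letters $S^{\pm 1}$, and $|w|$ denotes the length of a word $w$. Write $u \sim v$ if the words $u$ and $v$ represent conjugate elements of $G$. For words $u \sim v$, let $\mathrm{CL}(u,v)$ be the length of a shortest word $w$ such that $uw = wv$ in $G$. The conjugator length function $\mathrm{CL} : \mathbb{N} \to \mathbb{N}$ of $G$ is $$\mathrm{CL}(n) = \max\{\mathrm{CL}(u,v) \mid \text{words } u, v \text{ with } u \sim v \text{ in } G \text{ and } |u|+|v| \leq n\}.$$ For functions $f,g : \mathbb{N} \to \mathbb{N}$, write $f \preceq g$ if there exists a constant $C>0$ (which may be taken to be an integer) such that $f(n) \leq C g(Cn+C) + C$ for all $n \in \mathbb{N}$; write $f \simeq g$ if $f \preceq g$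 and $g \preceq f$. The $\simeq$-class of $\mathrm{CL}$ does not depend on the choice of finite generating set. *)

theory Defs
  imports "HOL-Algebra.Generated_Groups"
begin

text \<open>
  The letter \<open>(x, True)\<close> is the generator \<open>x\<close> and \<open>(x, False)\<close> is its formal inverse.  Words are
  not required to be freely reduced.
\<close>

type_synonym 'a letter = "'a \<times> bool"
type_synonym 'a word = "'a letter list"

abbreviation pos :: "'a \<Rightarrow> 'a letter" where
  "pos x \<equiv> (x, True)"

abbreviation neg :: "'a \<Rightarrow> 'a letter" where
  "neg x \<equiv> (x, False)"

definition words :: "'a set \<Rightarrow> 'a word set" where
  "words S = lists (S \<times> UNIV)"

fun letter_val :: "('g, 'r) monoid_scheme \<Rightarrow> 'g letter \<Rightarrow> 'g" where
  "letter_val G (x, e) = (if e then x else inv\<^bsub>G\<^esub> x)"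

definition word_val :: "('g, 'r) monoid_scheme \<Rightarrow> 'g word \<Rightarrow> 'g" where
  "word_val G w = foldr (\<lambda>l g. letter_val G l \<otimes>\<^bsub>G\<^esub> g) w \<one>\<^bsub>G\<^esub>"

definition conj_words :: "('g, 'r) monoid_scheme \<Rightarrow> 'g word \<Rightarrow> 'g word \<Rightarrow> bool" where
  "conj_words G u v \<longleftrightarrow>
     (\<exists>g\<in>carrier G. word_val G v = inv\<^bsub>G\<^esub> g \<otimes>\<^bsub>G\<^esub> word_val G u \<otimes>\<^bsub>G\<^esub> g)"

text \<open>
  Both definitions below are meaningful when \<open>S\<close> is a finite generating set of the group \<open>G\<close>:
  the minimum exists if \<open>u\<close> and \<open>v\<close> represent conjugate elements, and the maximum is
  taken over a finite nonempty set.
\<close>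

definition conj_length :: "('g, 'r) monoid_scheme \<Rightarrow> 'g set \<Rightarrow> 'g word \<Rightarrow> 'g word \<Rightarrow> nat" where
  "conj_length G S u v =
     (LEAST k. \<exists>w\<in>words S. length w = k \<and> word_val G (u @ w) = word_val G (w @ v))"

definition conj_length_fun :: "('g, 'r) monoid_scheme \<Rightarrow> 'g set \<Rightarrow> nat \<Rightarrow> nat" where
  "conj_length_fun G S n =
     Max {conj_length G S u v | u v.
            u \<in> words S \<and> v \<in> words S \<and> conj_words G u v \<and> length u + length v \<le> n}"

definition preceq :: "(nat \<Rightarrow> nat) \<Rightarrow> (nat \<Rightarrow> nat) \<Rightarrow> bool"  (infix \<open>\<preceq>\<close> 50) where
  "f \<preceq> g \<longleftrightarrow> (\<exists>C>0. \<forall>n. f n \<le> C * g (C * n + C) + C)"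

definition growth_equiv :: "(nat \<Rightarrow> nat) \<Rightarrow> (nat \<Rightarrow> nat) \<Rightarrow> bool"  (infix \<open>\<simeq>\<close> 50) where
  "f \<simeq> g \<longleftrightarrow> f \<preceq> g \<and> g \<preceq> f"

text \<open>
  A presentation consists of a set \<open>X\<close> of generators and a set \<open>R\<close> of pairs \<open>(u, v)\<close> of words, each
  standing for the defining relation \<open>u = v\<close>.  The presented group is the quotient of the monoid
  of words by the least congruence that contains \<open>R\<close> and makes \<open>(x, False)\<close> inverse to \<open>(x, True)\<close>.
\<close>

inductive_set pres_rel :: "'a set \<Rightarrow> ('a word \<times> 'a word) set \<Rightarrow> ('a word \<times> 'a word) set"
  for X :: "'a set" and R :: "('a word \<times> 'a word) set"
where
  refl: "w \<in> words X \<Longrightarrow> (w, w) \<in> pres_rel X R"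
| sym: "(u, v) \<in> pres_rel X R \<Longrightarrow> (v, u) \<in> pres_rel X R"
| trans: "(u, v) \<in> pres_rel X R \<Longrightarrow> (v, w) \<in> pres_rel X R \<Longrightarrow> (u, w) \<in> pres_rel X R"
| append: "(u, u') \<in> pres_rel X R \<Longrightarrow> (v, v') \<in> pres_rel X R \<Longrightarrow> (u @ v, u' @ v') \<in> pres_rel X R"
| cancel: "x \<in> X \<Longrightarrow> ([(x, e), (x, \<not> e)], []) \<in> pres_rel X R"
| rel: "(u, v) \<in> R \<Longrightarrow> u \<in> words X \<Longrightarrow> v \<in> words X \<Longrightarrow> (u, v) \<in> pres_rel X R"

definition presented_group :: "'a set \<Rightarrow> ('a word \<times> 'a word) set \<Rightarrow> 'a word set monoid" where
  "presented_group X R =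
     \<lparr>carrier = words X // pres_rel X R,
      mult = (\<lambda>A B. pres_rel X R `` {u @ v | u v. u \<in> A \<and> v \<in> B}),
      one = pres_rel X R `` {[]}\<rparr>"

definition pres_gen :: "'a set \<Rightarrow> ('a word \<times> 'a word) set \<Rightarrow> 'a \<Rightarrow> 'a word set" where
  "pres_gen X R x = pres_rel X R `` {[pos x]}"

lemma pres_rel_words: "(u, v) \<in> pres_rel X R \<Longrightarrow> u \<in> words X \<and> v \<in> words X"
  by (induction rule: pres_rel.induct) (auto simp: words_def)

lemma equiv_pres_rel: "equiv (words X) (pres_rel X R)"
proof (rule equivI)
  show "pres_rel X R \<subseteq> words X \<times> words X" by (auto dest: pres_rel_words)
  show "refl_on (words X) (pres_rel X R)" by (blast intro: refl_onI pres_rel.refl)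
  show "sym (pres_rel X R)" by (blast intro: symI pres_rel.sym)
  show "trans (pres_rel X R)" by (rule transI) (rule pres_rel.trans)
qed

lemma presented_group_mult_class:
  assumes "u \<in> words X" "v \<in> words X"
  shows "pres_rel X R `` {u} \<otimes>\<^bsub>presented_group X R\<^esub> pres_rel X R `` {v} = pres_rel X R `` {u @ v}"
proof -
  let ?r = "pres_rel X R"
  have self: "(u, u) \<in> ?r" "(v, v) \<in> ?r"
    using assms by (auto intro: pres_rel.refl)
  have "?r `` {x @ y | x y. x \<in> ?r `` {u} \<and> y \<in> ?r `` {v}} = ?r `` {u @ v}" (is "?A = ?B")
  proof (intro equalityI subsetI)
    fix w assume "w \<in> ?A"
    then obtain x y where "(u, x) \<in> ?r" "(v, y) \<in> ?r" "(x @ y, w) \<in> ?r" by blast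
    then have "(u @ v, w) \<in> ?r" using pres_rel.append pres_rel.trans by metis
    then show "w \<in> ?B" by simp
  next
    fix w assume "w \<in> ?B"
    then show "w \<in> ?A" using self by blast
  qed
  then show ?thesis by (simp add: presented_group_def)
qed

lemma presented_group_left_inverse:
  assumes "w \<in> words X"
  shows "\<exists>v\<in>words X. (v @ w, []) \<in> pres_rel X R"
  using assms unfolding words_def
proof (induction w rule: lists.induct)
  case Nil
  then show ?case
    by (intro bexI[of _ "[]"]) (simp_all add: pres_rel.refl words_def)
next
  case (Cons l w)
  then obtain v where v: "v \<in> lists (X \<times> UNIV)" "(v @ w, []) \<in> pres_rel X R" by blast
  obtain x e where l: "l = (x, e)" and x: "x \<in> X" using Cons.hyps(1) by (cases l) auto
  have r: "(v, v) \<in> pres_rel X R" "(w, w) \<in> pres_rel X R"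
    using v Cons.hyps(2) by (auto intro!: pres_rel.refl simp: words_def)
  have "([(x, \<not> e), (x, e)], []) \<in> pres_rel X R"
    using pres_rel.cancel[OF x, of "\<not> e"] by simp
  from pres_rel.append[OF r(1) pres_rel.append[OF this r(2)]]
  have "(v @ ([(x, \<not> e), (x, e)] @ w), v @ ([] @ w)) \<in> pres_rel X R" .
  then have "((v @ [(x, \<not> e)]) @ l # w, []) \<in> pres_rel X R"
    using pres_rel.trans[OF _ v(2)] l by simp
  then show ?case
    using v(1) x by (intro bexI[of _ "v @ [(x, \<not> e)]"]) auto
qed

lemma group_presented_group: "group (presented_group X R)"
proof (rule groupI)
  let ?G = "presented_group X R"
  have car: "carrier ?G = words X // pres_rel X R" and one: "\<one>\<^bsub>?G\<^esub> = pres_rel X R `` {[]}"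
    by (simp_all add: presented_group_def)
  have nil: "[] \<in> words X" and app: "\<And>u v. u \<in> words X \<Longrightarrow> v \<in> words X \<Longrightarrow> u @ v \<in> words X"
    by (auto simp: words_def)
  note mult = presented_group_mult_class
  show "\<one>\<^bsub>?G\<^esub> \<in> carrier ?G"
    using nil by (auto simp: car one intro: quotientI)
  fix A assume "A \<in> carrier ?G"
  then obtain u where u: "u \<in> words X" "A = pres_rel X R `` {u}"
    by (auto simp: car elim!: quotientE)
  show "\<one>\<^bsub>?G\<^esub> \<otimes>\<^bsub>?G\<^esub> A = A"
    using mult[OF nil u(1)] u(2) by (simp add: one)
  show "\<exists>B\<in>carrier ?G. B \<otimes>\<^bsub>?G\<^esub> A = \<one>\<^bsub>?G\<^esub>"
  proof -
    obtain v where v: "v \<in> words X" "(v @ u, []) \<in> pres_rel X R"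
      using presented_group_left_inverse[OF u(1)] by blast
    have "pres_rel X R `` {v} \<otimes>\<^bsub>?G\<^esub> A = \<one>\<^bsub>?G\<^esub>"
      unfolding u(2) mult[OF v(1) u(1)] one using v(2) by (rule equiv_class_eq[OF equiv_pres_rel])
    then show ?thesis
      using v(1) by (auto simp: car intro: quotientI)
  qed
  fix B assume "B \<in> carrier ?G"
  then obtain v where v: "v \<in> words X" "B = pres_rel X R `` {v}"
    by (auto simp: car elim!: quotientE)
  show "A \<otimes>\<^bsub>?G\<^esub> B \<in> carrier ?G"
    using mult[OF u(1) v(1)] app[OF u(1) v(1)] u(2) v(2) by (simp add: car quotientI)
  fix C assume "C \<in> carrier ?G"
  then obtain w where w: "w \<in> words X" "C = pres_rel X R `` {w}"
    by (auto simp: car elim!: quotientE)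
  show "A \<otimes>\<^bsub>?G\<^esub> B \<otimes>\<^bsub>?G\<^esub> C = A \<otimes>\<^bsub>?G\<^esub> (B \<otimes>\<^bsub>?G\<^esub> C)"
    using u v w app by (simp add: mult)
qed

lemma pres_gen_closed: "x \<in> X \<Longrightarrow> pres_gen X R x \<in> carrier (presented_group X R)"
  by (simp add: presented_group_def pres_gen_def quotientI words_def)

lemma generate_presented_group:
  "generate (presented_group X R) (pres_gen X R ` X) = carrier (presented_group X R)"
    (is "generate ?G ?S = _")
proof (rule equalityI)
  interpret G: group ?G by (rule group_presented_group)
  have S: "?S \<subseteq> carrier ?G" by (rule image_subsetI) (rule pres_gen_closed)
  show "generate ?G ?S \<subseteq> carrier ?G" by (rule G.generate_incl[OF S])
  have letter: "pres_rel X R `` {[(x, e)]} \<in> generate ?G ?S" if x: "x \<in> X" for x e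
  proof (cases e)
    case True
    then show ?thesis using x by (auto simp: pres_gen_def intro!: generate.incl)
  next
    case False
    have ws: "[(x, True)] \<in> words X" "[(x, False)] \<in> words X" using x by (auto simp: words_def)
    have "pres_rel X R `` {[(x, False)] @ [(x, True)]} = \<one>\<^bsub>?G\<^esub>"
      using equiv_class_eq[OF equiv_pres_rel pres_rel.cancel[OF x, of False]]
      by (simp add: presented_group_def)
    then have "pres_rel X R `` {[(x, False)]} \<otimes>\<^bsub>?G\<^esub> pres_gen X R x = \<one>\<^bsub>?G\<^esub>"
      using presented_group_mult_class[OF ws(2,1)] by (simp add: pres_gen_def)
    then have "inv\<^bsub>?G\<^esub> pres_gen X R x = pres_rel X R `` {[(x, False)]}"
      using pres_gen_closed[OF x] ws(2)
      by (intro G.inv_equality) (auto simp: presented_group_def intro: quotientI)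
    moreover have "inv\<^bsub>?G\<^esub> pres_gen X R x \<in> generate ?G ?S"
      using x by (intro generate.inv) auto
    ultimately show ?thesis using False by simp
  qed
  have "pres_rel X R `` {w} \<in> generate ?G ?S" if "w \<in> lists (X \<times> UNIV)" for w
    using that
  proof (induction w rule: lists.induct)
    case Nil
    then show ?case
      using generate.one[of ?G ?S] by (simp add: presented_group_def)
  next
    case (Cons l w)
    have "[l] \<in> words X" "w \<in> words X" using Cons.hyps by (auto simp: words_def)
    then have "pres_rel X R `` {l # w} = pres_rel X R `` {[l]} \<otimes>\<^bsub>?G\<^esub> pres_rel X R `` {w}"
      using presented_group_mult_class[of "[l]" X w R] by simp
    then show ?case
      using Cons letter by (cases l) (auto intro: generate.eng)
  qed
  then show "carrier ?G \<subseteq> generate ?G ?S"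
    by (auto simp: presented_group_def words_def elim!: quotientE)
qed

datatype gen = gen_a nat | gen_b nat | gen_c nat

definition G_gens :: "nat \<Rightarrow> gen set" where
  "G_gens m = gen_a ` {1..m} \<union> gen_b ` {1, 2} \<union> gen_c ` {1..m}"

abbreviation commute :: "gen \<Rightarrow> gen \<Rightarrow> gen word \<times> gen word" where
  "commute x y \<equiv> ([pos x, pos y], [pos y, pos x])"

definition G_rels :: "nat \<Rightarrow> (gen word \<times> gen word) set" where
  "G_rels m =
     {commute (gen_a i) (gen_a j) | i j. i \<in> {1..m} \<and> j \<in> {1..m}}
   \<union> {commute (gen_b 1) (gen_b 2)}
   \<union> {([pos (gen_b 1), pos (gen_a i)], [pos (gen_a i), pos (gen_b 1), pos (gen_c i)])
        | i. i \<in> {1..m}}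
   \<union> {([pos (gen_b 2), pos (gen_a i)], [pos (gen_a i), pos (gen_b 2), neg (gen_c (i + 1))])
        | i. i \<in> {1..<m}}
   \<union> {commute (gen_b 2) (gen_a m)}
   \<union> {commute (gen_c i) (gen_c j) | i j. i \<in> {1..m} \<and> j \<in> {1..m}}
   \<union> {commute (gen_a i) (gen_c j) | i j. i \<in> {1..m} \<and> j \<in> {1..m}}
   \<union> {commute (gen_b i) (gen_c j) | i j. i \<in> {1, 2} \<and> j \<in> {1..m}}"

definition G_group :: "nat \<Rightarrow> gen word set monoid" where
  "G_group m = presented_group (G_gens m) (G_rels m)"

definition G_genset :: "nat \<Rightarrow> gen word set set" where
  "G_genset m = pres_gen (G_gens m) (G_rels m) ` G_gens m"

end

(*
  Every element has a normal form a^x b^y c^z.  Reading x, y, z as polynomials in t, with y of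
  degree at most 1, the commutator of b^y and a^x is c to the power (y_1 - y_2 t) x(t) mod t^m, so a
  word with exponents (p, q) conjugates (x, y, z) to (x, y, z') iff
  (y_1 - y_2 t) p(t) - (q_1 - q_2 t) x(t) = z' - z, and CL is the l1-size of the smallest integer
  solution (p, q).  For words of length at most N the data are bounded by N and N^2.
  Upper bound: if y_1 is nonzero, inverting y_1 - y_2 t gives a rational solution with q = 0 of size
  O(N^(m+1)); any integer solution differs from it by a combination of two integer kernel vectors of
  size O(N^(m-1) + N), whose coefficients can be reduced to their fractional parts.
  Lower bound: x = 0, y = (1, n) and z' - z = (n^2, 0, ..., 0) force p_m = n^(m+1).
*)

theory Submission
  imports Defs Complex_Main
begin

text \<open>The exponent m + 1 is 2 + (m - 1): the data z' - z are quadratic in the word length, and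
  inverting y_1 - y_2 t multiplies them by y_2 / y_1 up to m - 1 times. The obstacle in the upper
  bound is integrality. The rational solution is small but need not be integral, while the integral
  solution supplied by conjugacy may be arbitrarily large; their difference lies in the rational
  kernel, so integer kernel vectors can move the large solution close to the small one. One kernel
  vector, (x; y_1, y_2), says that an element commutes with itself. The other starts from q = (0,
  1), which forces p = - t x(t) / (y_1 - y_2 t); a power of y_1 clears the denominators. If y_1 = 0,
  then y_1 - y_2 t has no inverse modulo t^m and another argument is required. For y_2 = 0 the
  unknown p disappears. Otherwise q determines p up to its last coefficient, and q itself is
  controlled by the lowest equation together with reduction modulo y_2.\<close>

definition unit_vec :: "gen letter \<Rightarrow> gen \<Rightarrow> int" where
  "unit_vec l s = (if s = fst l then if snd l then 1 else -1 else 0)"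

lemma unit_vec_Pair: "unit_vec (s, e) t = (if t = s then if e then 1 else -1 else 0)"
  by (simp add: unit_vec_def)

text \<open>The 2-cocycle of the central extension by the c_i: the exponent of
  \<open>gen_c i\<close> released when b^f moves to the right past a^g. It is also the coefficient
  of t^i in (f_1 - f_2 t) g(t).\<close>

definition twist :: "(gen \<Rightarrow> int) \<Rightarrow> (gen \<Rightarrow> int) \<Rightarrow> gen \<Rightarrow> int" where
  "twist f g s = (case s of
     gen_c i \<Rightarrow> f (gen_b 1) * g (gen_a i) - f (gen_b 2) * g (gen_a (i - 1)) | _ \<Rightarrow> 0)"

section \<open>Normal forms\<close>

text \<open>
  The exponent of a generator in the normal form $a^x b^y c^z$ of a word, in the group with
  infinitely many $a_i$ and $c_i$.  Truncating to \<open>G_gens m\<close> is harmless because \<open>twist\<close> at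
  \<open>gen_c i\<close> only involves $a_{i-1}$ and $a_i$; the junk generator \<open>gen_a 0\<close> never occurs in words
  over \<open>G_gens m\<close>.
\<close>

primrec ev :: "gen word \<Rightarrow> gen \<Rightarrow> int" where
  "ev [] = (\<lambda>s. 0)"
| "ev (l # w) = (\<lambda>s. unit_vec l s + ev w s + twist (unit_vec l) (ev w) s)"

lemma twist_simps [simp]:
  "twist f g (gen_a i) = 0" "twist f g (gen_b i) = 0"
  "twist f g (gen_c i) = f (gen_b 1) * g (gen_a i) - f (gen_b 2) * g (gen_a (i - 1))"
  by (simp_all add: twist_def)

text \<open>\<open>twist\<close> is bilinear and sees only the exponents of the a_i and b_j, which
  add under concatenation. This is the cocycle identity behind the induction.\<close>

lemma ev_append: "ev (u @ v) s = ev u s + ev v s + twist (ev u) (ev v) s"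
proof (induction u arbitrary: s)
  case Nil
  then show ?case by (cases s) simp_all
next
  case (Cons l u)
  then show ?case by (cases s) (simp_all add: algebra_simps)
qed

lemma ev_append_ab [simp]:
  "ev (u @ v) (gen_a i) = ev u (gen_a i) + ev v (gen_a i)"
  "ev (u @ v) (gen_b i) = ev u (gen_b i) + ev v (gen_b i)"
  by (simp_all add: ev_append)

lemma words_Cons: "l # w \<in> words X \<longleftrightarrow> fst l \<in> X \<and> w \<in> words X"
  by (cases l) (auto simp: words_def)

lemma words_append: "u @ v \<in> words X \<longleftrightarrow> u \<in> words X \<and> v \<in> words X"
  by (auto simp: words_def)

lemma words_Nil: "[] \<in> words X"
  by (simp add: words_def)

lemma mem_G_gens [simp]:
  "gen_a i \<in> G_gens m \<longleftrightarrow> 1 \<le> i \<and> i \<le> m"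
  "gen_b j \<in> G_gens m \<longleftrightarrow> j = 1 \<or> j = 2"
  "gen_c i \<in> G_gens m \<longleftrightarrow> 1 \<le> i \<and> i \<le> m"
  by (auto simp: G_gens_def)

lemma ev_a0: "w \<in> words (G_gens m) \<Longrightarrow> ev w (gen_a 0) = 0"
  by (induction w) (auto simp: words_Cons G_gens_def unit_vec_def)

text \<open>The invariants have to respect the defining relations and concatenation. The restriction
  to \<open>G_gens m\<close> matters: b_2 a_m = a_m b_2 is violated at
  \<open>gen_c (m + 1)\<close>.\<close>

lemma ev_sound:
  assumes "(u, v) \<in> pres_rel (G_gens m) (G_rels m)" "s \<in> G_gens m"
  shows "ev u s = ev v s"
  using assms
proof (induction arbitrary: s rule: pres_rel.induct)
  case (append u u' v v')
  have 0: "ev v (gen_a 0) = 0" "ev v' (gen_a 0) = 0"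
    using append.hyps pres_rel_words ev_a0 by blast+
  have "twist (ev u) (ev v) s = twist (ev u') (ev v') s"
  proof (cases s)
    case (gen_c i)
    then have i: "1 \<le> i" "i \<le> m" using append.prems by auto
    \<comment> \<open>For \<open>i = 1\<close> the index \<open>i - 1\<close> leaves the generating
      set; there both exponents vanish by \<open>ev_a0\<close>.\<close>
    have "i - 1 = 0 \<or> gen_a (i - 1) \<in> G_gens m" using i by auto
    then have "ev v (gen_a (i - 1)) = ev v' (gen_a (i - 1))"
      using append.IH(2) 0 by auto
    then show ?thesis
      using i append.IH(1)[of "gen_b 1"] append.IH(1)[of "gen_b 2"] append.IH(2)[of "gen_a i"]
      by (simp add: gen_c)
  qed simp_all
  then show ?case using append.IH append.prems by (simp add: ev_append)
next
  case (cancel x e)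
  then show ?case
    by (cases s) (auto simp: unit_vec_def)
next
  case (rel u v)
  then show ?case
    by (cases s) (auto simp: G_rels_def unit_vec_def)
qed (auto)

section \<open>Powers, ordered products and commutators in an arbitrary group\<close>

context group
begin

lemma commute_inv:
  assumes "g \<in> carrier G" "h \<in> carrier G" "g \<otimes> h = h \<otimes> g"
  shows "g \<otimes> inv h = inv h \<otimes> g"
  using assms by (metis inv_closed inv_solve_left inv_solve_right m_assoc m_closed)

lemma commute_int_pow:
  assumes "g \<in> carrier G" "h \<in> carrier G" "g \<otimes> h = h \<otimes> g"
  shows "g \<otimes> h [^] (n::int) = h [^] n \<otimes> g"
proof (cases n rule: int_cases2)
  case (nonneg k)
  then show ?thesis using group_commutes_pow[of h g k] assms by (simp add: int_pow_int)
next
  case (nonpos k)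
  then show ?thesis
    using group_commutes_pow[of h g k] commute_inv[of g "h [^] k"] assms
    by (simp add: int_pow_neg_int)
qed

text \<open>Conjugation by \<open>b\<close> is an endomorphism that sends \<open>a\<close> to
  \<open>a \<otimes> c\<close>, hence the n-th power of \<open>a\<close> to that of
  \<open>a \<otimes> c\<close>. This treats both signs of \<open>n\<close> at once.\<close>

lemma commutator_int_pow:
  assumes car: "a \<in> carrier G" "b \<in> carrier G" "c \<in> carrier G"
    and rel: "b \<otimes> a = a \<otimes> b \<otimes> c" and ca: "c \<otimes> a = a \<otimes> c" and cb: "c \<otimes> b = b \<otimes> c"
  shows "b \<otimes> a [^] (n::int) = a [^] n \<otimes> b \<otimes> c [^] n"
proof -
  have "group_hom G G (\<lambda>g. b \<otimes> g \<otimes> inv b)"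
    using car
    by unfold_locales (auto simp: hom_def m_assoc, simp add: m_assoc[symmetric])
  then interpret conj: group_hom G G "\<lambda>g. b \<otimes> g \<otimes> inv b" .
  have "b \<otimes> a \<otimes> inv b = a \<otimes> c"
    using car by (metis cb inv_solve_right' m_assoc m_closed rel)
  then have "b \<otimes> a [^] n \<otimes> inv b = (a \<otimes> c) [^] n"
    using conj.hom_int_pow[of a n] car by simp
  also have "\<dots> = a [^] n \<otimes> c [^] n"
    using int_pow_mult_distrib[of a c n] ca car by simp
  finally have "b \<otimes> a [^] n = a [^] n \<otimes> c [^] n \<otimes> b"
    using car by (metis inv_solve_right' int_pow_closed m_closed)
  then show ?thesis
    using commute_int_pow[of b c n] car cb by (simp add: m_assoc)
qed

primrec pow_prod :: "nat \<Rightarrow> (nat \<Rightarrow> 'a) \<Rightarrow> (nat \<Rightarrow> int) \<Rightarrow> 'a" where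
  "pow_prod 0 f x = \<one>"
| "pow_prod (Suc k) f x = pow_prod k f x \<otimes> f (Suc k) [^] x (Suc k)"

lemma pow_prod_closed:
  "\<forall>i\<in>{1..k}. f i \<in> carrier G \<Longrightarrow> pow_prod k f x \<in> carrier G"
  by (induction k) auto

lemma pow_prod_cong:
  "\<forall>i\<in>{1..k}. f i = f' i \<and> x i = x' i \<Longrightarrow> pow_prod k f x = pow_prod k f' x'"
  by (induction k) auto

lemma pow_prod_zero: "pow_prod k f (\<lambda>i. 0) = \<one>"
  by (induction k) auto

lemma commute_pow_prod:
  assumes "g \<in> carrier G" "\<forall>i\<in>{1..k}. f i \<in> carrier G \<and> g \<otimes> f i = f i \<otimes> g"
  shows "g \<otimes> pow_prod k f x = pow_prod k f x \<otimes> g"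
  using assms(2)
proof (induction k)
  case (Suc k)
  then have "g \<otimes> f (Suc k) [^] x (Suc k) = f (Suc k) [^] x (Suc k) \<otimes> g"
    using assms(1) by (intro commute_int_pow) auto
  moreover have "pow_prod k f x \<in> carrier G" using Suc.prems by (intro pow_prod_closed) auto
  ultimately show ?case using Suc assms(1) by (simp add: m_assoc[symmetric]) (simp add: m_assoc)
qed (simp add: assms(1))

lemma pow_prod_add:
  assumes "\<forall>i\<in>{1..k}. f i \<in> carrier G" "\<forall>i\<in>{1..k}. \<forall>j\<in>{1..k}. f i \<otimes> f j = f j \<otimes> f i"
  shows "pow_prod k f (\<lambda>i. x i + x' i) = pow_prod k f x \<otimes> pow_prod k f x'"
  using assms
proof (induction k)
  case (Suc k)
  let ?g = "f (Suc k)"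
  have car: "pow_prod k f x \<in> carrier G" "pow_prod k f x' \<in> carrier G" "?g \<in> carrier G"
    using Suc.prems by (auto intro!: pow_prod_closed)
  have "?g \<otimes> pow_prod k f x' = pow_prod k f x' \<otimes> ?g"
    using Suc.prems by (intro commute_pow_prod) auto
  then have "?g [^] x (Suc k) \<otimes> pow_prod k f x' = pow_prod k f x' \<otimes> ?g [^] x (Suc k)"
    using commute_int_pow[of "pow_prod k f x'" ?g] car by simp
  then have "pow_prod k f x \<otimes> pow_prod k f x' \<otimes> (?g [^] x (Suc k) \<otimes> ?g [^] x' (Suc k))
      = pow_prod k f x \<otimes> ?g [^] x (Suc k) \<otimes> (pow_prod k f x' \<otimes> ?g [^] x' (Suc k))"
    using car by (metis m_assoc int_pow_closed m_closed)
  then show ?case using Suc car by (simp add: int_pow_mult)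
qed simp

lemma commutator_pow_prod:
  assumes "b \<in> carrier G"
    and "\<forall>i\<in>{1..k}. f i \<in> carrier G \<and> c i \<in> carrier G \<and> b \<otimes> f i = f i \<otimes> b \<otimes> c i \<and> c i \<otimes> b = b \<otimes> c i"
    and "\<forall>i\<in>{1..k}. \<forall>j\<in>{1..k}. c i \<otimes> f j = f j \<otimes> c i \<and> c i \<otimes> c j = c j \<otimes> c i"
  shows "b \<otimes> pow_prod k f x = pow_prod k f x \<otimes> b \<otimes> pow_prod k c x"
  using assms
proof (induction k)
  case (Suc k)
  let ?A = "pow_prod k f x" and ?C = "pow_prod k c x" and ?n = "x (Suc k)"
  let ?a = "f (Suc k) [^] ?n" and ?c = "c (Suc k) [^] ?n"
  have car: "?A \<in> carrier G" "?C \<in> carrier G" "f (Suc k) \<in> carrier G" "?a \<in> carrier G" "?c \<in> carrier G"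
    using Suc.prems by (auto intro!: pow_prod_closed)
  have "f (Suc k) \<otimes> ?C = ?C \<otimes> f (Suc k)"
    using Suc.prems by (intro commute_pow_prod) auto
  then have aC: "?C \<otimes> ?a = ?a \<otimes> ?C"
    using commute_int_pow[of ?C "f (Suc k)" ?n] car by simp
  have "c (Suc k) \<otimes> ?C = ?C \<otimes> c (Suc k)"
    using Suc.prems by (intro commute_pow_prod) auto
  then have cC: "?c \<otimes> ?C = ?C \<otimes> ?c"
    using commute_int_pow[of ?C "c (Suc k)" ?n] car Suc.prems(2) by simp
  have ba: "b \<otimes> ?a = ?a \<otimes> b \<otimes> ?c"
    using Suc.prems by (intro commutator_int_pow) auto
  have IH: "b \<otimes> ?A = ?A \<otimes> b \<otimes> ?C" using Suc by auto
  have bC: "b \<otimes> ?C = ?C \<otimes> b"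
    using Suc.prems by (intro commute_pow_prod) auto
  have "b \<otimes> (?A \<otimes> ?a) = ?A \<otimes> b \<otimes> ?C \<otimes> ?a" using IH car Suc.prems(1) by (simp add: m_assoc[symmetric])
  also have "\<dots> = ?A \<otimes> b \<otimes> ?a \<otimes> ?C" using aC car Suc.prems(1) by (simp add: m_assoc)
  also have "\<dots> = ?A \<otimes> ?a \<otimes> b \<otimes> (?c \<otimes> ?C)" using ba car Suc.prems(1) by (metis m_assoc m_closed)
  finally show ?case using cC car Suc.prems(1) by (simp add: m_assoc)
qed simp

lemma pow_prod_unit:
  assumes "\<forall>j\<in>{1..k}. f j \<in> carrier G"
  shows "pow_prod k f (\<lambda>j. if j = i then e else 0) = (if i \<in> {1..k} then f i [^] e else \<one>)"
  using assms by (induction k) (auto simp: le_Suc_eq)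

lemma commute_mult:
  assumes "g \<in> carrier G" "h \<in> carrier G" "k \<in> carrier G" "g \<otimes> h = h \<otimes> g" "g \<otimes> k = k \<otimes> g"
  shows "g \<otimes> (h \<otimes> k) = h \<otimes> k \<otimes> g"
  using assms by (metis m_assoc)

lemma commute_left:
  assumes "g \<in> carrier G" "h \<in> carrier G" "k \<in> carrier G" "g \<otimes> h = h \<otimes> g"
  shows "g \<otimes> (h \<otimes> k) = h \<otimes> (g \<otimes> k)"
  using assms by (metis m_assoc)

text \<open>Provides the letters b_j^-1; \<open>a\<close> and \<open>c\<close> will be whole
  products \<open>A x\<close> and \<open>C z\<close>.\<close>

lemma commutator_inv:
  assumes "a \<in> carrier G" "b \<in> carrier G" "c \<in> carrier G"
    and "b \<otimes> a = a \<otimes> b \<otimes> c" "c \<otimes> b = b \<otimes> c"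
  shows "inv b \<otimes> a = a \<otimes> inv b \<otimes> inv c"
proof -
  have "b \<otimes> (a \<otimes> (inv b \<otimes> inv c)) = b \<otimes> a \<otimes> (inv b \<otimes> inv c)"
    using assms(1-3) by (simp add: m_assoc)
  also have i: "inv b \<otimes> inv c = inv (b \<otimes> c)" using assms by (metis inv_mult_group)
  also have "b \<otimes> a \<otimes> inv (b \<otimes> c) = a" using assms by (metis inv_solve_right' m_assoc m_closed)
  finally have "b \<otimes> (a \<otimes> inv b \<otimes> inv c) = a"
    using assms(1-3) by (simp add: m_assoc i)
  then show ?thesis using assms by (metis inv_solve_left inv_closed m_closed)
qed

end

section \<open>Completeness of the exponents: collecting words in the presented group\<close>

locale G_presentation =
  fixes m :: nat
  assumes m_pos: "1 \<le> m"
begin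

abbreviation "P \<equiv> G_group m"
abbreviation "X \<equiv> G_gens m"
abbreviation "R \<equiv> G_rels m"
definition cls :: "gen word \<Rightarrow> gen word set" where
  "cls w = pres_rel X R `` {w}"

definition el :: "gen \<Rightarrow> gen word set" where
  "el s = cls [pos s]"

sublocale group P
  unfolding G_group_def by (rule group_presented_group)

lemma cls_closed: "w \<in> words X \<Longrightarrow> cls w \<in> carrier P"
  by (simp add: cls_def G_group_def presented_group_def quotientI)

lemma cls_append:
  "u \<in> words X \<Longrightarrow> v \<in> words X \<Longrightarrow> cls (u @ v) = cls u \<otimes>\<^bsub>P\<^esub> cls v"
  by (simp add: cls_def G_group_def presented_group_mult_class)

lemma cls_Nil: "cls [] = \<one>\<^bsub>P\<^esub>"
  by (simp add: cls_def G_group_def presented_group_def)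

lemma cls_eq_iff: "u \<in> words X \<Longrightarrow> v \<in> words X \<Longrightarrow> cls u = cls v \<longleftrightarrow> (u, v) \<in> pres_rel X R"
  unfolding cls_def by (rule eq_equiv_class_iff[OF equiv_pres_rel])

lemma cls_Cons: "s \<in> X \<Longrightarrow> w \<in> words X \<Longrightarrow> cls ((s, e) # w) = cls [(s, e)] \<otimes>\<^bsub>P\<^esub> cls w"
  using cls_append[of "[(s, e)]" w] by (simp add: words_Cons words_Nil)

lemma carrier_cls: "g \<in> carrier P \<Longrightarrow> \<exists>w\<in>words X. g = cls w"
  by (auto simp: cls_def G_group_def presented_group_def elim!: quotientE)

lemma el_closed [simp]: "s \<in> X \<Longrightarrow> el s \<in> carrier P"
  unfolding el_def by (intro cls_closed) (simp add: words_Cons words_Nil)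

lemma cls_letter:
  assumes "s \<in> X"
  shows "cls [(s, e)] = el s [^]\<^bsub>P\<^esub> (if e then 1 else -1 :: int)"
proof (cases e)
  case False
  have w: "[(s, False)] \<in> words X" "[(s, True)] \<in> words X"
    using assms by (simp_all add: words_Cons words_Nil)
  have "cls [(s, False)] \<otimes>\<^bsub>P\<^esub> el s = cls []"
    using equiv_class_eq[OF equiv_pres_rel pres_rel.cancel[OF assms, of False R]]
    by (simp add: el_def cls_append[OF w, symmetric]) (simp add: cls_def)
  then have "inv\<^bsub>P\<^esub> el s = cls [(s, False)]"
    using w cls_closed assms by (intro inv_equality) (auto simp: cls_Nil el_def)
  then show ?thesis using False assms by (simp add: int_pow_neg)
qed (use assms in \<open>simp add: el_def[symmetric]\<close>)

lemma el_relation: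
  assumes "(u, v) \<in> R" "u \<in> words X" "v \<in> words X"
  shows "cls u = cls v"
  using assms by (simp add: cls_eq_iff pres_rel.rel)

lemma el_commute:
  assumes "commute s t \<in> R" "s \<in> X" "t \<in> X"
  shows "el s \<otimes>\<^bsub>P\<^esub> el t = el t \<otimes>\<^bsub>P\<^esub> el s"
  using el_relation[OF assms(1)] assms(2,3) cls_Cons[of s "[pos t]" True] cls_Cons[of t "[pos s]" True]
  by (simp add: el_def words_Cons words_Nil)

lemma el_a_commute:
  assumes "i \<in> {1..m}" "j \<in> {1..m}"
  shows "el (gen_a i) \<otimes>\<^bsub>P\<^esub> el (gen_a j) = el (gen_a j) \<otimes>\<^bsub>P\<^esub> el (gen_a i)"
proof (rule el_commute)
  show "commute (gen_a i) (gen_a j) \<in> R" using assms by (auto simp: G_rels_def)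
qed (use assms in simp_all)

lemma el_b_commute: "el (gen_b 1) \<otimes>\<^bsub>P\<^esub> el (gen_b 2) = el (gen_b 2) \<otimes>\<^bsub>P\<^esub> el (gen_b 1)"
proof (rule el_commute)
  show "commute (gen_b 1) (gen_b 2) \<in> R" by (auto simp: G_rels_def)
qed simp_all

lemma el_c_commute:
  assumes "i \<in> {1..m}" "s \<in> X"
  shows "el (gen_c i) \<otimes>\<^bsub>P\<^esub> el s = el s \<otimes>\<^bsub>P\<^esub> el (gen_c i)"
proof -
  have "commute s (gen_c i) \<in> R"
    using assms by (cases s) (auto simp: G_rels_def)
  then show ?thesis using assms el_commute[of s "gen_c i"] by auto
qed

lemma el_c_central:
  assumes "i \<in> {1..m}" "g \<in> carrier P"
  shows "el (gen_c i) \<otimes>\<^bsub>P\<^esub> g = g \<otimes>\<^bsub>P\<^esub> el (gen_c i)"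
proof -
  have c: "el (gen_c i) \<in> carrier P" using assms by simp
  obtain w where "w \<in> words X" "g = cls w" using carrier_cls assms(2) by blast
  moreover have "el (gen_c i) \<otimes>\<^bsub>P\<^esub> cls w = cls w \<otimes>\<^bsub>P\<^esub> el (gen_c i)" if "w \<in> words X"
    using that
  proof (induction w)
    case Nil
    then show ?case using c by (simp add: cls_Nil)
  next
    case (Cons l w)
    obtain s e where l: "l = (s, e)" by (cases l)
    have s: "s \<in> X" "w \<in> words X" using Cons.prems l by (auto simp: words_Cons)
    have lc: "cls [(s, e)] \<in> carrier P" using s by (intro cls_closed) (simp add: words_Cons words_Nil)
    have "el (gen_c i) \<otimes>\<^bsub>P\<^esub> cls [(s, e)] = cls [(s, e)] \<otimes>\<^bsub>P\<^esub> el (gen_c i)"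
      unfolding cls_letter[OF s(1), of e] 
      by (rule commute_int_pow[OF c el_closed[OF s(1)] el_c_commute[OF assms(1) s(1)]])
    from commute_mult[OF c lc cls_closed[OF s(2)] this Cons.IH[OF s(2)]]
    show ?case unfolding l cls_Cons[OF s] .
  qed
  ultimately show ?thesis by blast
qed

abbreviation "A x \<equiv> pow_prod m (\<lambda>i. el (gen_a i)) x"
abbreviation "C z \<equiv> pow_prod m (\<lambda>i. el (gen_c i)) z"

lemma A_closed [simp]: "A x \<in> carrier P"
  by (rule pow_prod_closed) simp

lemma C_closed [simp]: "C z \<in> carrier P"
  by (rule pow_prod_closed) simp

lemma C_central: "g \<in> carrier P \<Longrightarrow> g \<otimes>\<^bsub>P\<^esub> C z = C z \<otimes>\<^bsub>P\<^esub> g"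
  using el_c_central by (intro commute_pow_prod) auto

lemma A_add: "A (\<lambda>i. x i + x' i) = A x \<otimes>\<^bsub>P\<^esub> A x'"
  by (rule pow_prod_add) (simp_all add: el_a_commute)

lemma C_add: "C (\<lambda>i. z i + z' i) = C z \<otimes>\<^bsub>P\<^esub> C z'"
  by (rule pow_prod_add) (auto intro!: el_c_commute)

lemma C_minus: "C (\<lambda>i. - z i) = inv\<^bsub>P\<^esub> C z"
  using C_add[of "\<lambda>i. - z i" z] by (intro inv_equality[symmetric]) (simp_all add: pow_prod_zero)

lemma el_b1_a:
  assumes i: "i \<in> {1..m}"
  shows "el (gen_b 1) \<otimes>\<^bsub>P\<^esub> el (gen_a i) = el (gen_a i) \<otimes>\<^bsub>P\<^esub> el (gen_b 1) \<otimes>\<^bsub>P\<^esub> el (gen_c i)"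
proof -
  have "cls [pos (gen_b 1), pos (gen_a i)] = cls [pos (gen_a i), pos (gen_b 1), pos (gen_c i)]"
    using i by (intro el_relation) (auto simp: G_rels_def words_Cons words_Nil)
  then show ?thesis
    using i by (simp add: cls_Cons[of _ "[_]"] cls_Cons[of _ "[_, _]"] el_def[symmetric] words_Cons words_Nil m_assoc)
qed

lemma el_b2_a:
  assumes i: "i \<in> {1..m}"
  shows "el (gen_b 2) \<otimes>\<^bsub>P\<^esub> el (gen_a i) = el (gen_a i) \<otimes>\<^bsub>P\<^esub> el (gen_b 2) \<otimes>\<^bsub>P\<^esub>
    (if i = m then \<one>\<^bsub>P\<^esub> else inv\<^bsub>P\<^esub> el (gen_c (i + 1)))"
proof (cases "i = m")
  case True
  have "el (gen_b 2) \<otimes>\<^bsub>P\<^esub> el (gen_a i) = el (gen_a i) \<otimes>\<^bsub>P\<^esub> el (gen_b 2)"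
    using i True by (intro el_commute) (auto simp: G_rels_def)
  then show ?thesis using True i by simp
next
  case False
  have "cls [pos (gen_b 2), pos (gen_a i)] = cls [pos (gen_a i), pos (gen_b 2), neg (gen_c (i + 1))]"
    using i False by (intro el_relation) (auto simp: G_rels_def words_Cons words_Nil)
  moreover have "cls [neg (gen_c (i + 1))] = inv\<^bsub>P\<^esub> el (gen_c (i + 1))"
    using i False by (subst cls_letter) (auto simp: int_pow_neg)
  ultimately show ?thesis
    using i False
    by (simp add: cls_Cons[of _ "[_]"] cls_Cons[of _ "[_, _]"] el_def[symmetric] words_Cons words_Nil m_assoc)
qed

lemma el_b1_A:
  "el (gen_b 1) \<otimes>\<^bsub>P\<^esub> A x = A x \<otimes>\<^bsub>P\<^esub> el (gen_b 1) \<otimes>\<^bsub>P\<^esub> C x"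
  by (intro commutator_pow_prod ballI conjI el_c_commute el_b1_a el_closed; simp)

lemma el_b2_A:
  assumes "x 0 = 0"
  shows "el (gen_b 2) \<otimes>\<^bsub>P\<^esub> A x = A x \<otimes>\<^bsub>P\<^esub> el (gen_b 2) \<otimes>\<^bsub>P\<^esub> C (\<lambda>i. - x (i - 1))"
proof -
  let ?g = "\<lambda>i. if i = m then \<one>\<^bsub>P\<^esub> else inv\<^bsub>P\<^esub> el (gen_c (i + 1))"
  have car: "?g i \<in> carrier P" if "i \<in> {1..m}" for i using that by auto
  have cen: "?g i \<otimes>\<^bsub>P\<^esub> h = h \<otimes>\<^bsub>P\<^esub> ?g i" if "i \<in> {1..m}" "h \<in> carrier P" for i h
    using that commute_inv[of h "el (gen_c (i + 1))"] el_c_central[of "i + 1" h] by auto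
  have "el (gen_b 2) \<otimes>\<^bsub>P\<^esub> A x = A x \<otimes>\<^bsub>P\<^esub> el (gen_b 2) \<otimes>\<^bsub>P\<^esub> pow_prod m ?g x"
    by (intro commutator_pow_prod ballI conjI car cen el_b2_a el_closed; simp)
  \<comment> \<open>The power of c_(i+1)^-1 with exponent x_i belongs at index i + 1. The shifted
    product gets a new first factor with exponent - x_0 = 0, and the factor of \<open>?g\<close> at
    \<open>m\<close>, split off below, is trivial.\<close>
  moreover have "pow_prod k ?g x = pow_prod (Suc k) (\<lambda>i. el (gen_c i)) (\<lambda>i. - x (i - 1))" if "k < m" for k
    using that
  proof (induction k)
    case 0
    then show ?case using m_pos by (simp add: assms)
  next
    case (Suc k)
    then have "pow_prod (Suc k) ?g x = pow_prod (Suc k) (\<lambda>i. el (gen_c i)) (\<lambda>i. - x (i - 1))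
        \<otimes>\<^bsub>P\<^esub> inv\<^bsub>P\<^esub> el (gen_c (Suc (Suc k))) [^]\<^bsub>P\<^esub> x (Suc k)" by simp
    then show ?case using Suc.prems by (simp add: int_pow_inv int_pow_neg)
  qed
  from this[of "m - 1"] have "pow_prod (m - 1) ?g x = C (\<lambda>i. - x (i - 1))"
    using m_pos by (simp del: pow_prod.simps)
  moreover have "pow_prod (m - 1) ?g x \<in> carrier P"
    by (rule pow_prod_closed) (use car in force)
  then have "pow_prod (Suc (m - 1)) ?g x = pow_prod (m - 1) ?g x"
    using m_pos unfolding pow_prod.simps by simp
  then have "pow_prod m ?g x = pow_prod (m - 1) ?g x"
    using m_pos by (simp del: pow_prod.simps)
  ultimately show ?thesis by simp
qed

definition normal_form :: "(gen \<Rightarrow> int) \<Rightarrow> gen word set" where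
  "normal_form f = A (\<lambda>i. f (gen_a i)) \<otimes>\<^bsub>P\<^esub>
     (el (gen_b 1) [^]\<^bsub>P\<^esub> f (gen_b 1) \<otimes>\<^bsub>P\<^esub> el (gen_b 2) [^]\<^bsub>P\<^esub> f (gen_b 2)) \<otimes>\<^bsub>P\<^esub> C (\<lambda>i. f (gen_c i))"

lemma letter_b_A:
  assumes "f (gen_a 0) = 0" "j = 1 \<or> j = 2"
  shows "cls [(gen_b j, e)] \<otimes>\<^bsub>P\<^esub> A (\<lambda>i. f (gen_a i)) = A (\<lambda>i. f (gen_a i)) \<otimes>\<^bsub>P\<^esub>
    cls [(gen_b j, e)] \<otimes>\<^bsub>P\<^esub> C (\<lambda>i. twist (unit_vec (gen_b j, e)) f (gen_c i))"
proof -
  let ?t = "\<lambda>e i. twist (unit_vec (gen_b j, e)) f (gen_c i)"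
  have j: "gen_b j \<in> X" using assms by simp
  have pos: "el (gen_b j) \<otimes>\<^bsub>P\<^esub> A (\<lambda>i. f (gen_a i)) =
      A (\<lambda>i. f (gen_a i)) \<otimes>\<^bsub>P\<^esub> el (gen_b j) \<otimes>\<^bsub>P\<^esub> C (?t True)"
    using assms el_b1_A[of "\<lambda>i. f (gen_a i)"] el_b2_A[of "\<lambda>i. f (gen_a i)"]
    by (auto simp: unit_vec_def)
  show ?thesis
  proof (cases e)
    case False
    have t: "?t False = (\<lambda>i. - ?t True i)" by (auto simp: unit_vec_def)
    have "cls [(gen_b j, False)] = inv\<^bsub>P\<^esub> el (gen_b j)"
      using cls_letter[OF j, of False] j by (simp add: int_pow_neg)
    then show ?thesis
      using commutator_inv[OF A_closed el_closed[OF j] C_closed pos] C_central[OF el_closed[OF j]] False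
      by (simp only: t C_minus)
  qed (use pos in \<open>simp add: el_def\<close>)
qed

lemma b_letter_pow:
  assumes "j = 1 \<or> j = 2"
  shows "cls [(gen_b j, e)] \<otimes>\<^bsub>P\<^esub>
      (el (gen_b 1) [^]\<^bsub>P\<^esub> y1 \<otimes>\<^bsub>P\<^esub> el (gen_b 2) [^]\<^bsub>P\<^esub> y2) =
    el (gen_b 1) [^]\<^bsub>P\<^esub> (y1 + unit_vec (gen_b j, e) (gen_b 1)) \<otimes>\<^bsub>P\<^esub>
    el (gen_b 2) [^]\<^bsub>P\<^esub> (y2 + unit_vec (gen_b j, e) (gen_b 2))"
proof -
  let ?e = "if e then 1 else -1 :: int"
  have b: "el (gen_b 1) \<in> carrier P" "el (gen_b 2) \<in> carrier P" by simp_all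
  have "el (gen_b 2) [^]\<^bsub>P\<^esub> ?e \<otimes>\<^bsub>P\<^esub> el (gen_b 1) [^]\<^bsub>P\<^esub> y1
      = el (gen_b 1) [^]\<^bsub>P\<^esub> y1 \<otimes>\<^bsub>P\<^esub> el (gen_b 2) [^]\<^bsub>P\<^esub> ?e"
    using b el_b_commute by (intro commute_int_pow commute_int_pow[symmetric]) auto
  then have 2: "el (gen_b 2) [^]\<^bsub>P\<^esub> ?e \<otimes>\<^bsub>P\<^esub>
      (el (gen_b 1) [^]\<^bsub>P\<^esub> y1 \<otimes>\<^bsub>P\<^esub> el (gen_b 2) [^]\<^bsub>P\<^esub> y2)
      = el (gen_b 1) [^]\<^bsub>P\<^esub> y1 \<otimes>\<^bsub>P\<^esub> el (gen_b 2) [^]\<^bsub>P\<^esub> (y2 + ?e)"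
    using b by (simp only: add.commute[of y2] int_pow_mult m_assoc[symmetric] int_pow_closed)
  have 1: "el (gen_b 1) [^]\<^bsub>P\<^esub> ?e \<otimes>\<^bsub>P\<^esub>
      (el (gen_b 1) [^]\<^bsub>P\<^esub> y1 \<otimes>\<^bsub>P\<^esub> el (gen_b 2) [^]\<^bsub>P\<^esub> y2)
      = el (gen_b 1) [^]\<^bsub>P\<^esub> (y1 + ?e) \<otimes>\<^bsub>P\<^esub> el (gen_b 2) [^]\<^bsub>P\<^esub> y2"
    using b by (simp only: add.commute[of y1] int_pow_mult m_assoc[symmetric] int_pow_closed)
  show ?thesis
    using assms 1 2 cls_letter[of "gen_b j" e] by (auto simp: unit_vec_def)
qed

text \<open>The recursion of \<open>ev\<close> carried out in the group: a letter a_i merges into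
  the first block, a letter c_i is central, and a letter b_j passes the first block at the cost of
  the central factor given by \<open>twist\<close>.\<close>

lemma normal_form_Cons:
  assumes "s \<in> X" "w \<in> words X"
  shows "normal_form (ev ((s, e) # w)) = cls [(s, e)] \<otimes>\<^bsub>P\<^esub> normal_form (ev w)"
proof -
  let ?f = "ev w" and ?l = "cls [(s, e)]" and ?e = "if e then 1 else -1 :: int"
  let ?B = "el (gen_b 1) [^]\<^bsub>P\<^esub> ?f (gen_b 1) \<otimes>\<^bsub>P\<^esub> el (gen_b 2) [^]\<^bsub>P\<^esub> ?f (gen_b 2)"
  have B: "?B \<in> carrier P" by (simp del: One_nat_def)
  have l: "?l \<in> carrier P" using assms by (intro cls_closed) (simp add: words_Cons words_Nil)
  note closed = B l A_closed C_closed
  show ?thesis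
  proof (cases s)
    case (gen_a i)
    have "A (\<lambda>j. ev ((s, e) # w) (gen_a j)) = ?l \<otimes>\<^bsub>P\<^esub> A (\<lambda>j. ?f (gen_a j))"
      using pow_prod_unit[of m "\<lambda>i. el (gen_a i)" i ?e] assms gen_a cls_letter[of s e]
        A_add[of "\<lambda>j. if j = i then ?e else 0" "\<lambda>j. ?f (gen_a j)"]
      by (simp add: unit_vec_Pair split del: if_split)
    then show ?thesis
      using closed by (simp add: normal_form_def gen_a unit_vec_def m_assoc)
  next
    case (gen_b j)
    then have j: "j = 1 \<or> j = 2" using assms by simp
    let ?t = "\<lambda>i. twist (unit_vec (s, e)) ?f (gen_c i)"
    have "?l \<otimes>\<^bsub>P\<^esub> normal_form ?f = ?l \<otimes>\<^bsub>P\<^esub> A (\<lambda>j. ?f (gen_a j)) \<otimes>\<^bsub>P\<^esub> ?B \<otimes>\<^bsub>P\<^esub> C (\<lambda>j. ?f (gen_c j))"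
      unfolding normal_form_def using closed by (simp only: m_assoc m_closed)
    also have "\<dots> = A (\<lambda>j. ?f (gen_a j)) \<otimes>\<^bsub>P\<^esub> ?l \<otimes>\<^bsub>P\<^esub> C ?t \<otimes>\<^bsub>P\<^esub> ?B \<otimes>\<^bsub>P\<^esub> C (\<lambda>j. ?f (gen_c j))"
      using letter_b_A[of ?f j e] ev_a0[OF assms(2)] j gen_b by simp
    also have "\<dots> = A (\<lambda>j. ?f (gen_a j)) \<otimes>\<^bsub>P\<^esub> (?l \<otimes>\<^bsub>P\<^esub> ?B) \<otimes>\<^bsub>P\<^esub> (C ?t \<otimes>\<^bsub>P\<^esub> C (\<lambda>j. ?f (gen_c j)))"
      using commute_left[OF B C_closed C_closed C_central[OF B]] closed by (simp only: m_assoc m_closed)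
    also have "\<dots> = normal_form (ev ((s, e) # w))"
      unfolding normal_form_def C_add[symmetric] gen_b b_letter_pow[OF j]
      by (simp add: unit_vec_def add_ac)
    finally show ?thesis by simp
  next
    case (gen_c i)
    have "C (\<lambda>j. ev ((s, e) # w) (gen_c j)) = ?l \<otimes>\<^bsub>P\<^esub> C (\<lambda>j. ?f (gen_c j))"
      using pow_prod_unit[of m "\<lambda>i. el (gen_c i)" i ?e] assms gen_c cls_letter[of s e]
        C_add[of "\<lambda>j. if j = i then ?e else 0" "\<lambda>j. ?f (gen_c j)"]
      by (simp add: unit_vec_Pair split del: if_split)
    moreover have "?l \<otimes>\<^bsub>P\<^esub> g = g \<otimes>\<^bsub>P\<^esub> ?l" if "g \<in> carrier P" for g
      unfolding cls_letter[OF assms(1), of e] using that assms el_c_central[of i g] gen_c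
      by (intro commute_int_pow[symmetric]) auto
    then have "?l \<otimes>\<^bsub>P\<^esub> normal_form ?f =
        A (\<lambda>j. ?f (gen_a j)) \<otimes>\<^bsub>P\<^esub> ?B \<otimes>\<^bsub>P\<^esub> (?l \<otimes>\<^bsub>P\<^esub> C (\<lambda>j. ?f (gen_c j)))"
      unfolding normal_form_def using closed by (intro commute_left) (simp_all only: m_closed)
    ultimately show ?thesis
      by (simp add: normal_form_def gen_c unit_vec_def)
  qed
qed

lemma cls_normal_form: "w \<in> words X \<Longrightarrow> cls w = normal_form (ev w)"
proof (induction w)
  case Nil
  then show ?case by (simp add: normal_form_def pow_prod_zero cls_Nil)
next
  case (Cons l w)
  then show ?case
    using normal_form_Cons[of "fst l" w "snd l"] cls_Cons[of "fst l" w "snd l"] by (simp add: words_Cons)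
qed

text \<open>Solution of the word problem: one direction is the soundness of \<open>ev\<close>, the
  other rewrites both words to the same normal form.\<close>

lemma cls_eq_ev:
  assumes "u \<in> words X" "v \<in> words X"
  shows "cls u = cls v \<longleftrightarrow> (\<forall>s\<in>X. ev u s = ev v s)"
proof
  assume "cls u = cls v"
  then show "\<forall>s\<in>X. ev u s = ev v s" using assms cls_eq_iff ev_sound by blast
next
  assume eq: "\<forall>s\<in>X. ev u s = ev v s"
  have "A (\<lambda>i. ev u (gen_a i)) = A (\<lambda>i. ev v (gen_a i))"
    "C (\<lambda>i. ev u (gen_c i)) = C (\<lambda>i. ev v (gen_c i))"
    by (rule pow_prod_cong, use eq in simp)+
  then have "normal_form (ev u) = normal_form (ev v)"
    using eq by (simp add: normal_form_def)
  then show "cls u = cls v" using assms by (simp add: cls_normal_form)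
qed

end

section \<open>Small solutions of the conjugacy equation\<close>

text \<open>
  Coefficientwise form of $(y_1 - y_2 t)\, p(t) - (q_1 - q_2 t)\, x(t) = d(t)$ mod $t^m$, where the
  sequences start at index 1; it is always used with \<open>x 0 = 0\<close>.
\<close>

definition conj_eq ::
  "nat \<Rightarrow> (nat \<Rightarrow> int) \<Rightarrow> int \<Rightarrow> int \<Rightarrow> (nat \<Rightarrow> int) \<Rightarrow> (nat \<Rightarrow> int) \<Rightarrow> int \<Rightarrow> int \<Rightarrow> bool" where
  "conj_eq m x y1 y2 d p q1 q2 \<longleftrightarrow>
     p 0 = 0 \<and> (\<forall>i\<in>{1..m}. y1 * p i - y2 * p (i - 1) - (q1 * x i - q2 * x (i - 1)) = d i)"

lemma conj_eqD:
  "conj_eq m x y1 y2 d p q1 q2 \<Longrightarrow> 1 \<le> i \<Longrightarrow> i \<le> m \<Longrightarrow>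
    y1 * p i - y2 * p (i - 1) - (q1 * x i - q2 * x (i - 1)) = d i"
  by (simp add: conj_eq_def)

lemma abs_le_of_mult_eq:
  fixes a b c :: int
  assumes "a * b = c" "a \<noteq> 0"
  shows "\<bar>b\<bar> \<le> \<bar>c\<bar>"
proof -
  have "1 * \<bar>b\<bar> \<le> \<bar>a\<bar> * \<bar>b\<bar>" using assms(2) by (intro mult_right_mono) auto
  then show ?thesis using assms(1) by (simp add: abs_mult[symmetric])
qed

text \<open>Here p drops out and can be taken to be 0. If x_k is the lowest nonzero coefficient of
  x, the system is triangular: equation k determines q_1, then equation k + 1 determines
  q_2.\<close>

lemma conj_eq_bounded_zero:
  fixes x d p :: "nat \<Rightarrow> int" and q1 q2 N :: int
  assumes N: "1 \<le> N" and x0: "x 0 = 0" and x: "\<forall>i\<in>{1..m}. \<bar>x i\<bar> \<le> N"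
    and d: "\<forall>i\<in>{1..m}. \<bar>d i\<bar> \<le> N\<^sup>2" and sol: "conj_eq m x 0 0 d p q1 q2"
  shows "\<exists>p' q1' q2'. conj_eq m x 0 0 d p' q1' q2' \<and> \<bar>q1'\<bar> \<le> 2 * N ^ (m + 1) \<and>
    \<bar>q2'\<bar> \<le> 2 * N ^ (m + 1) \<and> (\<forall>i\<in>{1..m}. \<bar>p' i\<bar> \<le> N ^ (m + 1))"
proof (cases "\<forall>i\<in>{1..m}. x i = 0")
  case True
  have "\<forall>i\<in>{1..m}. x (i - 1) = 0"
  proof
    fix i assume "i \<in> {1..m}"
    then have "i - 1 = 0 \<or> i - 1 \<in> {1..m}" by auto
    then show "x (i - 1) = 0" using True x0 by metis
  qed
  then have "conj_eq m x 0 0 d (\<lambda>_. 0) 0 0" using sol True by (auto simp: conj_eq_def)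
  then show ?thesis using N by (intro exI[of _ "\<lambda>_. 0"] exI[of _ 0]) auto
next
  case False
  define k where "k = (LEAST i. x i \<noteq> 0)"
  obtain i0 where i0: "i0 \<in> {1..m}" "x i0 \<noteq> 0" using False by blast
  have xk: "x k \<noteq> 0" unfolding k_def by (rule LeastI[of _ i0]) (rule i0)
  have k0: "x i = 0" if "i < k" for i using not_less_Least[of i] that unfolding k_def by blast
  have km: "k \<le> m" using Least_le[of "\<lambda>i. x i \<noteq> 0" i0] i0 unfolding k_def by auto
  have k1: "1 \<le> k" using xk x0 by (cases k) auto
  have "x k * - q1 = d k"
    using conj_eqD[OF sol k1 km] k0[of "k - 1"] k1 by (simp add: mult.commute)
  then have "\<bar>- q1\<bar> \<le> \<bar>d k\<bar>" using xk by (rule abs_le_of_mult_eq)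
  then have q1N: "\<bar>q1\<bar> \<le> N\<^sup>2" using d km k1 by (smt (verit) atLeastAtMost_iff)
  moreover have pow: "N\<^sup>2 \<le> N ^ (m + 1)" using N km k1 by (intro power_increasing) auto
  ultimately have q1: "\<bar>q1\<bar> \<le> 2 * N ^ (m + 1)" using zero_le_power[of N "m+1"] N by linarith
  show ?thesis
  proof (cases "k < m")
    case True
    have "- (q1 * x (k + 1) - q2 * x k) = d (k + 1)"
      using conj_eqD[OF sol, of "k + 1"] True by simp
    then have "x k * q2 = d (k + 1) + q1 * x (k + 1)" by (simp add: algebra_simps)
    then have "\<bar>q2\<bar> \<le> \<bar>d (k + 1) + q1 * x (k + 1)\<bar>" using xk by (rule abs_le_of_mult_eq)
    also have "\<dots> \<le> \<bar>d (k + 1)\<bar> + \<bar>q1\<bar> * \<bar>x (k + 1)\<bar>" by (simp add: abs_mult[symmetric])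
    also have "\<dots> \<le> N\<^sup>2 + N\<^sup>2 * N"
      using d x True k1 q1N by (intro add_mono mult_mono) auto
    also have "N\<^sup>2 * N = N ^ 3" by (simp add: power3_eq_cube power2_eq_square)
    \<comment> \<open>From 1 <= k < m follows m >= 2, so the cubic bound fits.\<close>
    also have "N ^ 3 \<le> N ^ (m + 1)" using N True k1 by (intro power_increasing) auto
    finally have "\<bar>q2\<bar> \<le> 2 * N ^ (m + 1)" using pow by linarith
    moreover have "conj_eq m x 0 0 d (\<lambda>_. 0) q1 q2" using sol by (simp add: conj_eq_def)
    ultimately show ?thesis using q1 N
      by (intro exI[of _ "\<lambda>_. 0"] exI[of _ q1] exI[of _ q2]) auto
  next
    case False
    \<comment> \<open>For k = m every coefficient that multiplies q_2 vanishes, so q_2 may be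
      replaced by 0.\<close>
    then have "x (i - 1) = 0" if "i \<in> {1..m}" for i using that k0[of "i - 1"] by auto
    then have "conj_eq m x 0 0 d (\<lambda>_. 0) q1 0" using sol by (auto simp: conj_eq_def)
    then show ?thesis using q1 N
      by (intro exI[of _ "\<lambda>_. 0"] exI[of _ q1] exI[of _ 0]) auto
  qed
qed

lemma conj_eq_bounded_snd:
  fixes x d p :: "nat \<Rightarrow> int" and y2 q1 q2 N :: int
  assumes m: "1 \<le> m" and N: "1 \<le> N" and x0: "x 0 = 0" and x: "\<forall>i\<in>{1..m}. \<bar>x i\<bar> \<le> N"
    and d: "\<forall>i\<in>{1..m}. \<bar>d i\<bar> \<le> N\<^sup>2" and y2: "y2 \<noteq> 0" "\<bar>y2\<bar> \<le> N"
    and sol: "conj_eq m x 0 y2 d p q1 q2"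
  shows "\<exists>p' q1' q2'. conj_eq m x 0 y2 d p' q1' q2' \<and> \<bar>q1'\<bar> \<le> N ^ (m + 1) \<and>
    \<bar>q2'\<bar> \<le> N ^ (m + 1) \<and> (\<forall>i\<in>{1..m}. \<bar>p' i\<bar> \<le> 3 * N ^ (m + 1))"
proof -
  have pow: "N\<^sup>2 \<le> N ^ (m + 1)" "N \<le> N\<^sup>2"
    using N m power_increasing[of 2 "m + 1" N] power_increasing[of 1 2 N] by auto
  have md: "\<bar>q mod y2\<bar> \<le> N" for q using abs_mod_less[of y2 q] y2 by linarith
  define k where "k = q2 div y2"
  define r2 where "r2 = q2 mod y2"
  define p1 where "p1 = (\<lambda>i. p i - k * x i)"
  have q2: "q2 = k * y2 + r2" by (simp add: k_def r2_def)
  have sol1: "conj_eq m x 0 y2 d p1 q1 r2"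
    using sol x0 by (auto simp: conj_eq_def p1_def q2 algebra_simps)
  have r2: "\<bar>r2\<bar> \<le> N" unfolding r2_def by (rule md)
  have "\<exists>p2 r1. conj_eq m x 0 y2 d p2 r1 r2 \<and> \<bar>r1\<bar> \<le> N\<^sup>2"
  proof (cases "x 1 = 0")
    case False
    have "0 * p1 1 - y2 * p1 0 - (q1 * x 1 - r2 * x 0) = d 1"
      using conj_eqD[OF sol1, of 1] m by simp
    then have "x 1 * - q1 = d 1" using sol1 x0 by (simp add: conj_eq_def mult.commute)
    then have "\<bar>- q1\<bar> \<le> \<bar>d 1\<bar>" using False by (rule abs_le_of_mult_eq)
    also have "\<dots> \<le> N\<^sup>2" using d m by simp
    finally show ?thesis using sol1 by auto
  next
    case True
    \<comment> \<open>As $x_1 = 0$, shifting $x$ down by one gives a kernel vector with $q = (y_2, 0)$.\<close>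
    define l where "l = q1 div y2"
    have q1: "q1 = l * y2 + q1 mod y2" by (simp add: l_def)
    have "conj_eq m x 0 y2 d (\<lambda>i. p1 i + l * x (i + 1)) (q1 mod y2) r2"
      unfolding conj_eq_def
    proof (intro conjI ballI)
      show "p1 0 + l * x (0 + 1) = 0" using sol1 True by (simp add: conj_eq_def)
      fix i assume i: "i \<in> {1..m}"
      have "d i = 0 * p1 i - y2 * p1 (i - 1) - ((l * y2 + q1 mod y2) * x i - r2 * x (i - 1))"
        using sol1 i unfolding conj_eq_def q1[symmetric] by simp
      then show "0 * (p1 i + l * x (i + 1)) - y2 * (p1 (i - 1) + l * x (i - 1 + 1)) -
          (q1 mod y2 * x i - r2 * x (i - 1)) = d i"
        using i by (simp add: algebra_simps)
    qed
    then show ?thesis using md[of q1] pow by (intro exI) (rule conjI, assumption, linarith)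
  qed
  then obtain p2 r1 where sol2: "conj_eq m x 0 y2 d p2 r1 r2" and r1: "\<bar>r1\<bar> \<le> N\<^sup>2" by blast
  have p2: "\<bar>p2 i\<bar> \<le> 3 * N ^ (m + 1)" if i: "i \<in> {1..m}" "i \<noteq> m" for i
  proof -
    have "y2 * p2 i = - d (i + 1) - r1 * x (i + 1) + r2 * x i"
      using conj_eqD[OF sol2, of "i + 1"] i by simp
    then have "\<bar>p2 i\<bar> \<le> \<bar>- d (i + 1) - r1 * x (i + 1) + r2 * x i\<bar>"
      using y2(1) by (rule abs_le_of_mult_eq)
    also have "\<dots> \<le> \<bar>d (i + 1)\<bar> + \<bar>r1\<bar> * \<bar>x (i + 1)\<bar> + \<bar>r2\<bar> * \<bar>x i\<bar>"
      unfolding abs_mult[symmetric] by linarith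
    also have "\<dots> \<le> N\<^sup>2 + N\<^sup>2 * N + N * N"
      using d x i r1 r2 N by (intro add_mono mult_mono) auto
    also have "\<dots> = N\<^sup>2 + N\<^sup>2 + N ^ 3" by (simp add: power3_eq_cube power2_eq_square)
    \<comment> \<open>An index \<open>i\<close> in \<open>{1..m}\<close> other than \<open>m\<close>
      exists only if m >= 2.\<close>
    also have "N ^ 3 \<le> N ^ (m + 1)" using N i by (intro power_increasing) auto
    finally show ?thesis using pow by linarith
  qed
  have "conj_eq m x 0 y2 d (\<lambda>i. if i = m then 0 else p2 i) r1 r2"
    using sol2 m by (auto simp: conj_eq_def)
  then show ?thesis
    using p2 r1 r2 pow N
    by (intro exI[of _ "\<lambda>i. if i = m then 0 else p2 i"] exI[of _ r1] exI[of _ r2]) auto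
qed

text \<open>The coefficients of $d(t) / (y_1 - y_2 t)$, the rational solution with $q = 0$.\<close>

primrec real_sol :: "(nat \<Rightarrow> int) \<Rightarrow> int \<Rightarrow> int \<Rightarrow> nat \<Rightarrow> real" where
  "real_sol d y1 y2 0 = 0"
| "real_sol d y1 y2 (Suc i) = (d (Suc i) + y2 * real_sol d y1 y2 i) / y1"

text \<open>Each step multiplies by at most N, adds at most N^2 <= N^(i+2), and divides by a nonzero
  integer, which cannot increase the size.\<close>

lemma real_sol_bound:
  fixes N :: int
  assumes "1 \<le> N" "y1 \<noteq> 0" "\<bar>y2\<bar> \<le> N" "\<forall>j\<in>{1..i}. \<bar>d j\<bar> \<le> N\<^sup>2"
  shows "\<bar>real_sol d y1 y2 i\<bar> \<le> i * N ^ (i + 1)"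
  using assms(4)
proof (induction i)
  case (Suc i)
  let ?s = "real_sol d y1 y2 i"
  have N: "1 \<le> real_of_int N" "1 \<le> \<bar>real_of_int y1\<bar>" "\<bar>real_of_int y2\<bar> \<le> N"
    using assms by linarith+
  have "\<bar>d (Suc i)\<bar> \<le> N\<^sup>2" using Suc.prems by simp
  then have d: "\<bar>real_of_int (d (Suc i))\<bar> \<le> real_of_int N ^ 2"
    by (metis of_int_abs of_int_le_iff of_int_power)
  have "\<bar>?s\<bar> \<le> i * N ^ (i + 1)" using Suc by simp
  then have t: "\<bar>real_of_int y2\<bar> * \<bar>?s\<bar> \<le> N * (i * N ^ (i + 1))"
    using N by (simp del: power_Suc) (intro mult_mono, auto)
  have "\<bar>real_sol d y1 y2 (Suc i)\<bar> = \<bar>d (Suc i) + y2 * ?s\<bar> / \<bar>real_of_int y1\<bar>" by simp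
  also have "\<dots> \<le> \<bar>d (Suc i) + y2 * ?s\<bar> / 1" using N by (intro divide_left_mono) auto
  also have "\<dots> \<le> \<bar>real_of_int (d (Suc i))\<bar> + \<bar>real_of_int y2\<bar> * \<bar>?s\<bar>"
    unfolding abs_mult[symmetric] div_by_1 by (rule abs_triangle_ineq)
  also have "\<dots> \<le> real_of_int N ^ 2 + N * (i * N ^ (i + 1))"
    using add_mono[OF d t] by simp
  also have "real_of_int N ^ 2 \<le> real_of_int N ^ (i + 2)" using N by (intro power_increasing) auto
  finally show ?case by (simp add: algebra_simps)
qed simp

text \<open>Since y_1 - y_2 t is invertible over the rationals, q determines p: the rational
  solutions form an affine plane parametrized by q.\<close>

lemma conj_eq_bounded_fst:
  fixes x d p :: "nat \<Rightarrow> int" and y1 y2 q1 q2 N :: int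
  assumes m: "1 \<le> m" and N: "1 \<le> N" and x0: "x 0 = 0" and x: "\<forall>i\<in>{1..m}. \<bar>x i\<bar> \<le> N"
    and d: "\<forall>i\<in>{1..m}. \<bar>d i\<bar> \<le> N\<^sup>2" and y: "y1 \<noteq> 0" "\<bar>y1\<bar> \<le> N" "\<bar>y2\<bar> \<le> N"
    and sol: "conj_eq m x y1 y2 d p q1 q2"
  shows "\<exists>p' q1' q2'. conj_eq m x y1 y2 d p' q1' q2' \<and> \<bar>q1'\<bar> \<le> 2 * N ^ (m + 1) \<and>
    \<bar>q2'\<bar> \<le> 2 * N ^ (m + 1) \<and> (\<forall>i\<in>{1..m}. \<bar>p' i\<bar> \<le> (2 * int m + 1) * N ^ (m + 1))"
proof -
  \<comment> \<open>The kernel is spanned over the rationals by $(p; q) = (x; y_1, y_2)$ and $(-P; 0, Y)$.\<close>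
  define Y where "Y = y1 ^ (m - 1)"
  \<comment> \<open>\<open>P\<close> is Y t x(t) / (y_1 - y_2 t). The geometric series gives the
    terms x_j y_2^(i-j-1) / y_1^(i-j), where i - j <= m - 1 for i <= m, so the factor
    \<open>Y\<close> clears every denominator.\<close>
  define P where "P = (\<lambda>i. \<Sum>j\<in>{1..<i}. x j * y1 ^ (m - 1 - (i - j)) * y2 ^ (i - j - 1))"
  have Y: "Y \<noteq> 0" "\<bar>Y\<bar> \<le> N ^ (m + 1)"
  proof -
    have "\<bar>Y\<bar> \<le> N ^ (m - 1)" unfolding Y_def power_abs using y by (intro power_mono) auto
    also have "\<dots> \<le> N ^ (m + 1)" using N by (intro power_increasing) auto
    finally show "\<bar>Y\<bar> \<le> N ^ (m + 1)" .
  qed (use y in \<open>simp add: Y_def\<close>)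
  have P_rec: "y1 * P (Suc k) - y2 * P k = x k * Y" if k: "k < m" for k
  proof (cases "k = 0")
    case False
    have "y1 * P (Suc k) = (\<Sum>j\<in>{1..<Suc k}. x j * y1 ^ (m - (Suc k - j)) * y2 ^ (k - j))"
      unfolding P_def sum_distrib_left
    proof (rule sum.cong)
      fix j assume j: "j \<in> {1..<Suc k}"
      then have "m - (Suc k - j) = Suc (m - 1 - (Suc k - j))" using k by auto
      then show "y1 * (x j * y1 ^ (m - 1 - (Suc k - j)) * y2 ^ (Suc k - j - 1)) =
          x j * y1 ^ (m - (Suc k - j)) * y2 ^ (k - j)" using j by (simp add: Suc_diff_le)
    qed simp
    also have "\<dots> = (\<Sum>j\<in>{1..<k}. x j * y1 ^ (m - (Suc k - j)) * y2 ^ (k - j)) + x k * Y"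
      using False by (simp add: Y_def)
    also have "(\<Sum>j\<in>{1..<k}. x j * y1 ^ (m - (Suc k - j)) * y2 ^ (k - j)) = y2 * P k"
      unfolding P_def sum_distrib_left
    proof (rule sum.cong)
      fix j assume j: "j \<in> {1..<k}"
      then have "k - j = Suc (k - j - 1)" "m - (Suc k - j) = m - 1 - (k - j)" by auto
      then show "x j * y1 ^ (m - (Suc k - j)) * y2 ^ (k - j) =
          y2 * (x j * y1 ^ (m - 1 - (k - j)) * y2 ^ (k - j - 1))"
        by (metis mult.left_commute power_Suc)
    qed simp
    finally show ?thesis by simp
  qed (simp add: P_def x0)
  have P_bound: "\<bar>P i\<bar> \<le> m * N ^ (m + 1)" if i: "i \<in> {1..m}" for i
  proof -
    have "\<bar>P i\<bar> \<le> (\<Sum>j\<in>{1..<i}. \<bar>x j * y1 ^ (m - 1 - (i - j)) * y2 ^ (i - j - 1)\<bar>)"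
      unfolding P_def by (rule sum_abs)
    also have "\<dots> \<le> (\<Sum>j\<in>{1..<i}. N ^ (m + 1))"
    proof (rule sum_mono)
      fix j assume j: "j \<in> {1..<i}"
      have "\<bar>x j * y1 ^ (m - 1 - (i - j)) * y2 ^ (i - j - 1)\<bar>
          \<le> N * N ^ (m - 1 - (i - j)) * N ^ (i - j - 1)"
        unfolding abs_mult power_abs using x y j i N by (intro mult_mono power_mono) auto
      also have "\<dots> = N ^ (1 + (m - 1 - (i - j)) + (i - j - 1))" by (simp add: power_add)
      also have "\<dots> \<le> N ^ (m + 1)" using N i j by (intro power_increasing) auto
      finally show "\<bar>x j * y1 ^ (m - 1 - (i - j)) * y2 ^ (i - j - 1)\<bar> \<le> N ^ (m + 1)" .
    qed
    also have "\<dots> = int (i - 1) * N ^ (m + 1)" by simp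
    also have "\<dots> \<le> m * N ^ (m + 1)" using i N by (intro mult_right_mono) auto
    finally show ?thesis .
  qed
  \<comment> \<open>Real coordinates of the given solution in the kernel basis, read off from q = l1
    (y_1, y_2) + l2 (0, Y). Subtracting their integer parts keeps the solution integral.\<close>
  define l1 :: real where "l1 = q1 / y1"
  define l2 :: real where "l2 = (q2 - l1 * y2) / Y"
  define p' where "p' = (\<lambda>i. p i - \<lfloor>l1\<rfloor> * x i + \<lfloor>l2\<rfloor> * P i)"
  define q1' where "q1' = q1 - \<lfloor>l1\<rfloor> * y1"
  define q2' where "q2' = q2 - \<lfloor>l1\<rfloor> * y2 - \<lfloor>l2\<rfloor> * Y"
  have l1: "l1 * y1 = q1" and l2: "l2 * Y = q2 - l1 * y2" using y Y by (simp_all add: l1_def l2_def)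
  have sol': "conj_eq m x y1 y2 d p' q1' q2'"
    unfolding conj_eq_def
  proof (intro conjI ballI)
    show "p' 0 = 0" using sol x0 by (simp add: conj_eq_def p'_def P_def)
    fix i assume i: "i \<in> {1..m}"
    then have "i - 1 < m" "Suc (i - 1) = i" by auto
    then have "y1 * P i - y2 * P (i - 1) = x (i - 1) * Y" using P_rec[of "i - 1"] by simp
    then have 1: "y1 * P i = y2 * P (i - 1) + x (i - 1) * Y" by simp
    have 2: "d i = y1 * p i - y2 * p (i - 1) - (q1 * x i - q2 * x (i - 1))"
      using sol i by (simp add: conj_eq_def)
    have "y1 * p' i = y1 * p i - \<lfloor>l1\<rfloor> * x i * y1 + \<lfloor>l2\<rfloor> * (y2 * P (i - 1) + x (i - 1) * Y)"
      unfolding p'_def 1[symmetric] by (simp add: algebra_simps)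
    then show "y1 * p' i - y2 * p' (i - 1) - (q1' * x i - q2' * x (i - 1)) = d i"
      unfolding 2 q1'_def q2'_def by (simp add: p'_def algebra_simps)
  qed
  \<comment> \<open>Both sides satisfy the same recursion with the same q, and y_1 is nonzero, so
    they agree.\<close>
  have p_eq: "p i = real_sol d y1 y2 i + l1 * x i - l2 * P i" if "i \<le> m" for i
    using that
  proof (induction i)
    case 0
    then show ?case using sol x0 by (simp add: conj_eq_def P_def)
  next
    case (Suc i)
    have e: "real_of_int y1 * p (Suc i) = y2 * p i + q1 * x (Suc i) - q2 * x i + d (Suc i)"
    proof -
      have "y1 * p (Suc i) = y2 * p i + q1 * x (Suc i) - q2 * x i + d (Suc i)"
        using conj_eqD[OF sol, of "Suc i"] Suc.prems by simp
      then show ?thesis by (metis of_int_add of_int_diff of_int_mult)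
    qed
    have P: "real_of_int y1 * P (Suc i) = y2 * P i + x i * Y"
    proof -
      have "y1 * P (Suc i) = y2 * P i + x i * Y" using P_rec[of i] Suc.prems by simp
      then show ?thesis by (metis of_int_add of_int_mult)
    qed
    have s: "real_of_int y1 * real_sol d y1 y2 (Suc i) = d (Suc i) + y2 * real_sol d y1 y2 i"
      using y by simp
    have "real_of_int y1 * (real_sol d y1 y2 (Suc i) + l1 * x (Suc i) - l2 * P (Suc i))
      = d (Suc i) + y2 * real_sol d y1 y2 i + (l1 * y1) * x (Suc i) - l2 * (y2 * P i + x i * Y)"
      unfolding s[symmetric] P[symmetric] by (simp add: algebra_simps)
    also have "\<dots> = d (Suc i) + y2 * (real_sol d y1 y2 i - l2 * P i) + q1 * x (Suc i) - (l2 * Y) * x i"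
      unfolding l1 by (simp add: algebra_simps)
    also have "\<dots> = y2 * (real_sol d y1 y2 i + l1 * x i - l2 * P i) + q1 * x (Suc i) - q2 * x i + d (Suc i)"
      unfolding l2 by (simp add: algebra_simps)
    also have "\<dots> = real_of_int y1 * p (Suc i)" using e Suc by simp
    finally show ?case using y by simp
  qed
  have fr: "\<bar>frac t * real_of_int a\<bar> \<le> \<bar>real_of_int a\<bar>" for t :: real and a
    using mult_right_mono[of "frac t" 1 "\<bar>real_of_int a\<bar>"] frac_ge_0[of t] frac_lt_1[of t]
    by (simp add: abs_mult)
  have NN: "N \<le> N ^ (m + 1)" using N power_increasing[of 1 "m + 1" N] by simp
  have "real_of_int q1' = frac l1 * y1"
    using l1 by (simp add: q1'_def frac_def algebra_simps)
  then have "\<bar>q1'\<bar> \<le> \<bar>y1\<bar>" using fr[of l1 y1] by linarith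
  then have q1': "\<bar>q1'\<bar> \<le> 2 * N ^ (m + 1)" using y NN by linarith
  have "real_of_int q2' = frac l1 * y2 + frac l2 * Y"
    using l2 by (simp add: q2'_def frac_def algebra_simps)
  then have "\<bar>q2'\<bar> \<le> \<bar>y2\<bar> + \<bar>Y\<bar>" using fr[of l1 y2] fr[of l2 Y] by linarith
  then have q2': "\<bar>q2'\<bar> \<le> 2 * N ^ (m + 1)" using y Y NN by linarith
  have p': "\<bar>p' i\<bar> \<le> (2 * int m + 1) * N ^ (m + 1)" if i: "i \<in> {1..m}" for i
  proof -
    have "real_of_int (p' i) = real_sol d y1 y2 i + frac l1 * x i - frac l2 * P i"
      using p_eq[of i] i by (simp add: p'_def frac_def algebra_simps)
    moreover have "\<bar>real_sol d y1 y2 i\<bar> \<le> i * N ^ (i + 1)"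
      using N y d i by (intro real_sol_bound) auto
    ultimately have "\<bar>real_of_int (p' i)\<bar> \<le> i * N ^ (i + 1) + \<bar>real_of_int (x i)\<bar> + \<bar>real_of_int (P i)\<bar>"
      using fr[of l1 "x i"] fr[of l2 "P i"] by linarith
    then have "\<bar>p' i\<bar> \<le> i * N ^ (i + 1) + \<bar>x i\<bar> + \<bar>P i\<bar>"
      by linarith
    also have "int i * N ^ (i + 1) \<le> m * N ^ (m + 1)"
      using i N by (intro mult_mono power_increasing) auto
    also have "\<bar>x i\<bar> \<le> N ^ (m + 1)" using x i NN by force
    also have "\<bar>P i\<bar> \<le> m * N ^ (m + 1)" using P_bound i by blast
    finally show ?thesis by (simp add: algebra_simps)
  qed
  show ?thesis by (intro exI[of _ p'] exI[of _ q1'] exI[of _ q2'] conjI ballI sol' q1' q2' p')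
qed

text \<open>The constant 2 m + 1 comes from the case of nonzero \<open>y1\<close>: m for the
  rational solution, 1 for x and m for \<open>P\<close>. As m >= 1 it is at least 3, which covers
  the other cases.\<close>

lemma conj_eq_bounded:
  fixes x d p :: "nat \<Rightarrow> int" and y1 y2 q1 q2 N :: int
  assumes m: "1 \<le> m" and N: "1 \<le> N" and x0: "x 0 = 0" and x: "\<forall>i\<in>{1..m}. \<bar>x i\<bar> \<le> N"
    and d: "\<forall>i\<in>{1..m}. \<bar>d i\<bar> \<le> N\<^sup>2" and y: "\<bar>y1\<bar> \<le> N" "\<bar>y2\<bar> \<le> N"
    and sol: "conj_eq m x y1 y2 d p q1 q2"
  obtains p' q1' q2' where "conj_eq m x y1 y2 d p' q1' q2'"
    "\<bar>q1'\<bar> \<le> (2 * int m + 1) * N ^ (m + 1)" "\<bar>q2'\<bar> \<le> (2 * int m + 1) * N ^ (m + 1)"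
    "\<forall>i\<in>{1..m}. \<bar>p' i\<bar> \<le> (2 * int m + 1) * N ^ (m + 1)"
proof -
  have mono: "c * N ^ (m + 1) \<le> (2 * int m + 1) * N ^ (m + 1)" if "c \<le> 3" for c :: int
    using that m N by (intro mult_right_mono) auto
  have le: "N ^ (m + 1) \<le> (2 * int m + 1) * N ^ (m + 1)" "2 * N ^ (m + 1) \<le> (2 * int m + 1) * N ^ (m + 1)"
    "3 * N ^ (m + 1) \<le> (2 * int m + 1) * N ^ (m + 1)"
    using mono[of 1] mono[of 2] mono[of 3] by (simp_all only: mult_1)
  show thesis
  proof (cases "y1 = 0")
    case False
    from conj_eq_bounded_fst[OF m N x0 x d False y sol] obtain p' q1' q2' where
      *: "conj_eq m x y1 y2 d p' q1' q2'" "\<bar>q1'\<bar> \<le> 2 * N ^ (m + 1)" "\<bar>q2'\<bar> \<le> 2 * N ^ (m + 1)"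
      "\<forall>i\<in>{1..m}. \<bar>p' i\<bar> \<le> (2 * int m + 1) * N ^ (m + 1)" by blast
    show thesis
      by (rule that[OF *(1) order_trans[OF *(2) le(2)] order_trans[OF *(3) le(2)] *(4)])
  next
    case y1: True
    show thesis
    proof (cases "y2 = 0")
      case True
      from conj_eq_bounded_zero[OF N x0 x d sol[unfolded y1 True]] obtain p' q1' q2' where
        *: "conj_eq m x y1 y2 d p' q1' q2'" "\<bar>q1'\<bar> \<le> 2 * N ^ (m + 1)" "\<bar>q2'\<bar> \<le> 2 * N ^ (m + 1)"
        "\<forall>i\<in>{1..m}. \<bar>p' i\<bar> \<le> N ^ (m + 1)" using y1 True by blast
      have "\<forall>i\<in>{1..m}. \<bar>p' i\<bar> \<le> (2 * int m + 1) * N ^ (m + 1)"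
        using *(4) le(1) order_trans by blast
      then show thesis
        by (rule that[OF *(1) order_trans[OF *(2) le(2)] order_trans[OF *(3) le(2)]])
    next
      case False
      from conj_eq_bounded_snd[OF m N x0 x d False y(2) sol[unfolded y1]] obtain p' q1' q2' where
        *: "conj_eq m x y1 y2 d p' q1' q2'" "\<bar>q1'\<bar> \<le> N ^ (m + 1)" "\<bar>q2'\<bar> \<le> N ^ (m + 1)"
        "\<forall>i\<in>{1..m}. \<bar>p' i\<bar> \<le> 3 * N ^ (m + 1)" using y1 by blast
      have "\<forall>i\<in>{1..m}. \<bar>p' i\<bar> \<le> (2 * int m + 1) * N ^ (m + 1)"
        using *(4) le(3) order_trans by blast
      then show thesis
        by (rule that[OF *(1) order_trans[OF *(2) le(1)] order_trans[OF *(3) le(1)]])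
    qed
  qed
qed

section \<open>The conjugator length function\<close>

definition gen_pow :: "gen \<Rightarrow> int \<Rightarrow> gen word" where
  "gen_pow s k = replicate (nat \<bar>k\<bar>) (s, 0 \<le> k)"

primrec a_word :: "nat \<Rightarrow> (nat \<Rightarrow> int) \<Rightarrow> gen word" where
  "a_word 0 p = []"
| "a_word (Suc k) p = a_word k p @ gen_pow (gen_a (Suc k)) (p (Suc k))"

lemma length_gen_pow [simp]: "length (gen_pow s k) = nat \<bar>k\<bar>"
  by (simp add: gen_pow_def)

lemma gen_pow_words: "s \<in> Y \<Longrightarrow> gen_pow s k \<in> words Y"
  by (auto simp: gen_pow_def words_def)

lemma a_word_words: "\<forall>i\<in>{1..k}. gen_a i \<in> Y \<Longrightarrow> a_word k p \<in> words Y"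
  by (induction k) (auto simp: words_Nil words_append gen_pow_words)

lemma length_a_word: "\<forall>i\<in>{1..k}. \<bar>p i\<bar> \<le> B \<Longrightarrow> int (length (a_word k p)) \<le> k * B"
proof (induction k)
  case (Suc k)
  then have "\<bar>p (Suc k)\<bar> \<le> B" "int (length (a_word k p)) \<le> k * B" by auto
  then show ?case by (simp add: algebra_simps)
qed simp

lemma ev_gen_pow [simp]: "ev (gen_pow s k) t = (if t = s then k else 0)"
proof -
  have "ev (replicate n (s, e)) t = (if t = s then if e then int n else - int n else 0)" for n e
    by (induction n arbitrary: t) (auto simp: unit_vec_def twist_def split: gen.splits)
  then show ?thesis by (simp add: gen_pow_def)
qed

lemma ev_a_word [simp]:
  "ev (a_word k p) (gen_a i) = (if i \<in> {1..k} then p i else 0)"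
  "ev (a_word k p) (gen_b j) = 0"
  by (induction k) auto

lemma unit_vec_le: "\<bar>unit_vec l s\<bar> \<le> 1"
  by (simp add: unit_vec_def)

lemma ev_ab_le:
  "\<bar>ev w (gen_a i)\<bar> \<le> length w" "\<bar>ev w (gen_b j)\<bar> \<le> length w"
proof (induction w)
  case (Cons l w)
  {
    case 1
    show ?case using Cons(1) unit_vec_le[of l "gen_a i"] by simp
  next
    case 2
    show ?case using Cons(2) unit_vec_le[of l "gen_b j"] by simp
  }
qed simp_all

text \<open>A new first letter changes the exponent by at most 2 k + 1 = (k + 1)^2 - k^2, where k is
  the length of the rest.\<close>

lemma ev_c_le: "\<bar>ev w (gen_c i)\<bar> \<le> (int (length w))\<^sup>2"
proof (induction w)
  case (Cons l w)
  let ?k = "int (length w)" and ?u = "unit_vec l"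
  have "\<bar>?u (gen_c i) + (?u (gen_b 1) * ev w (gen_a i) - ?u (gen_b 2) * ev w (gen_a (i - 1)))\<bar> \<le> 2 * ?k + 1"
    using ev_ab_le(1)[of w i] ev_ab_le(1)[of w "i - 1"]
    by (cases l; cases "fst l") (auto simp: unit_vec_def)
  then have "\<bar>ev (l # w) (gen_c i)\<bar> \<le> ?k\<^sup>2 + (2 * ?k + 1)" using Cons by simp
  then show ?case by (simp add: power2_eq_square algebra_simps)
qed simp

section \<open>From words in symbols to words in group elements\<close>

context G_presentation
begin

abbreviation "S \<equiv> G_genset m"

text \<open>\<open>conj_length_fun\<close> measures words whose letters are group elements, whereas
  \<open>ev\<close> reads symbols. This map preserves length and is onto by
  \<open>words_genset\<close>, so the minima on the two sides agree.\<close>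

definition lift :: "gen word \<Rightarrow> gen word set word" where
  "lift w = map (\<lambda>(s, e). (el s, e)) w"

lemma length_lift [simp]: "length (lift w) = length w"
  by (simp add: lift_def)

lemma lift_append: "lift (u @ v) = lift u @ lift v"
  by (simp add: lift_def)

lemma G_genset_eq: "S = el ` X"
  by (simp add: G_genset_def pres_gen_def el_def cls_def)

lemma words_genset: "W \<in> words S \<longleftrightarrow> (\<exists>w\<in>words X. W = lift w)"
proof (induction W)
  case Nil
  have "lift [] = []" by (simp add: lift_def)
  then show ?case using words_Nil[of X] words_Nil[of S] by metis
next
  case (Cons L W)
  show ?case
  proof
    assume "L # W \<in> words S"
    then obtain s w where "s \<in> X" "fst L = el s" "w \<in> words X" "W = lift w"
      using Cons by (auto simp: words_Cons G_genset_eq)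
    then have "(s, snd L) # w \<in> words X" "L # W = lift ((s, snd L) # w)"
      by (auto simp: words_Cons lift_def prod_eq_iff)
    then show "\<exists>w\<in>words X. L # W = lift w" by blast
  next
    assume "\<exists>w\<in>words X. L # W = lift w"
    then obtain l w where lw: "l # w \<in> words X" "L # W = lift (l # w)"
      by (metis length_lift length_Suc_conv list.distinct(1) length_0_conv neq_Nil_conv)
    then have "W = lift w" "fst L = el (fst l)" by (auto simp: lift_def split: prod.splits)
    moreover have "fst l \<in> X" "w \<in> words X" using lw(1) by (simp_all add: words_Cons)
    ultimately show "L # W \<in> words S" unfolding words_Cons using Cons G_genset_eq by blast
  qed
qed

lemma word_val_lift: "w \<in> words X \<Longrightarrow> word_val P (lift w) = cls w"
proof (induction w)
  case Nil
  then show ?case by (simp add: lift_def word_val_def cls_Nil)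
next
  case (Cons l w)
  obtain s e where l: "l = (s, e)" by (cases l)
  have s: "s \<in> X" "w \<in> words X" using Cons.prems l by (auto simp: words_Cons)
  have "letter_val P (el s, e) = cls [(s, e)]"
    using cls_letter[OF s(1), of e] s(1) by (simp add: int_pow_neg)
  then show ?case
    using Cons.IH[OF s(2)] cls_Cons[OF s, of e] by (simp add: l lift_def word_val_def)
qed

definition conjugates :: "gen word \<Rightarrow> gen word \<Rightarrow> gen word \<Rightarrow> bool" where
  "conjugates w u v \<longleftrightarrow> cls (u @ w) = cls (w @ v)"

lemma conj_words_lift:
  assumes "u \<in> words X" "v \<in> words X"
  shows "conj_words P (lift u) (lift v) \<longleftrightarrow> (\<exists>w\<in>words X. conjugates w u v)"
proof -
  have *: "cls v = inv\<^bsub>P\<^esub> g \<otimes>\<^bsub>P\<^esub> cls u \<otimes>\<^bsub>P\<^esub> g \<longleftrightarrow> cls u \<otimes>\<^bsub>P\<^esub> g = g \<otimes>\<^bsub>P\<^esub> cls v"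
    if "g \<in> carrier P" for g
    using that cls_closed assms by (metis inv_closed inv_solve_left m_assoc m_closed)
  have "conjugates w u v \<longleftrightarrow> cls u \<otimes>\<^bsub>P\<^esub> cls w = cls w \<otimes>\<^bsub>P\<^esub> cls v" if "w \<in> words X" for w
    using that assms by (simp add: conjugates_def cls_append)
  then show ?thesis
    unfolding conj_words_def word_val_lift[OF assms(1)] word_val_lift[OF assms(2)]
    using * carrier_cls cls_closed by metis
qed

lemma conj_length_lift:
  assumes "u \<in> words X" "v \<in> words X"
  shows "conj_length P S (lift u) (lift v) = (LEAST k. \<exists>w\<in>words X. length w = k \<and> conjugates w u v)"
proof -
  have "word_val P (lift u @ lift w) = word_val P (lift w @ lift v) \<longleftrightarrow> conjugates w u v"
    if "w \<in> words X" for w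
    using assms that
    by (simp add: lift_append[symmetric] word_val_lift words_append conjugates_def)
  then have "(\<exists>W\<in>words S. length W = k \<and> word_val P (lift u @ W) = word_val P (W @ lift v)) \<longleftrightarrow>
      (\<exists>w\<in>words X. length w = k \<and> conjugates w u v)" for k
    using words_genset length_lift by metis
  then show ?thesis by (simp add: conj_length_def)
qed

text \<open>The c_i are central, so their exponents in \<open>w\<close> cancel. Once the other
  exponents of \<open>u\<close> and \<open>v\<close> agree, what remains is the difference of the
  two \<open>twist\<close> terms.\<close>

lemma conjugates_iff:
  assumes "u \<in> words X" "v \<in> words X" "w \<in> words X"
  shows "conjugates w u v \<longleftrightarrow>
    (\<forall>i\<in>{1..m}. ev u (gen_a i) = ev v (gen_a i)) \<and> (\<forall>j\<in>{1, 2}. ev u (gen_b j) = ev v (gen_b j)) \<and>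
    conj_eq m (\<lambda>i. ev v (gen_a i)) (ev v (gen_b 1)) (ev v (gen_b 2))
      (\<lambda>i. ev v (gen_c i) - ev u (gen_c i)) (\<lambda>i. ev w (gen_a i)) (ev w (gen_b 1)) (ev w (gen_b 2))"
proof -
  have "conjugates w u v \<longleftrightarrow> (\<forall>s\<in>X. ev (u @ w) s = ev (w @ v) s)"
    unfolding conjugates_def using assms by (intro cls_eq_ev) (auto simp: words_append)
  also have "\<dots> \<longleftrightarrow> (\<forall>i\<in>{1..m}. ev u (gen_a i) = ev v (gen_a i)) \<and>
      (\<forall>j\<in>{1, 2}. ev u (gen_b j) = ev v (gen_b j)) \<and>
      (\<forall>i\<in>{1..m}. ev (u @ w) (gen_c i) = ev (w @ v) (gen_c i))"
    unfolding G_gens_def by (auto simp: ball_Un)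
  finally show ?thesis
    using ev_a0[OF assms(3)] by (auto simp: ev_append conj_eq_def algebra_simps)
qed

section \<open>Upper bound\<close>

abbreviation "K \<equiv> (m + 2) * (2 * m + 1)"

lemma conj_length_le:
  assumes u: "u \<in> words X" and v: "v \<in> words X" and "\<exists>w\<in>words X. conjugates w u v"
    and n: "length u + length v \<le> n"
  shows "conj_length P S (lift u) (lift v) \<le> K * (n + 1) ^ (m + 1)"
proof -
  obtain w where w: "w \<in> words X" "conjugates w u v" using assms by blast
  \<comment> \<open>The shift by 1 guarantees \<open>1 \<le> N\<close> also for
    \<open>n = 0\<close>.\<close>
  define N where "N = int (n + 1)"
  define B where "B = (2 * int m + 1) * N ^ (m + 1)"
  have len: "int (length v) \<le> N" using n by (simp add: N_def)
  have le: "\<bar>ev v (gen_a i)\<bar> \<le> N" "\<bar>ev v (gen_b i)\<bar> \<le> N" for i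
    using ev_ab_le[of v i] len by (meson order_trans)+
  have d: "\<bar>ev v (gen_c i) - ev u (gen_c i)\<bar> \<le> N\<^sup>2" for i
  proof -
    have "\<bar>ev v (gen_c i) - ev u (gen_c i)\<bar> \<le> (int (length v))\<^sup>2 + (int (length u))\<^sup>2"
      using ev_c_le[of v i] ev_c_le[of u i] by linarith
    also have "\<dots> \<le> (int (length v) + int (length u))\<^sup>2" by (simp add: power2_sum)
    also have "\<dots> \<le> N\<^sup>2" using n by (intro power_mono) (auto simp: N_def)
    finally show ?thesis .
  qed
  note c = w(2)[unfolded conjugates_iff[OF u v w(1)]]
  have N: "1 \<le> N" by (simp add: N_def)
  obtain p q1 q2 where s: "conj_eq m (\<lambda>i. ev v (gen_a i)) (ev v (gen_b 1)) (ev v (gen_b 2))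
      (\<lambda>i. ev v (gen_c i) - ev u (gen_c i)) p q1 q2"
    "\<bar>q1\<bar> \<le> B" "\<bar>q2\<bar> \<le> B" "\<forall>i\<in>{1..m}. \<bar>p i\<bar> \<le> B"
    unfolding B_def
    by (rule conj_eq_bounded[OF m_pos N _ _ _ _ _ c[THEN conjunct2, THEN conjunct2]])
      (use ev_a0[OF v] le d in auto)
  \<comment> \<open>Letters c_i would only lengthen the conjugator without affecting what it
    conjugates.\<close>
  define w' where "w' = a_word m p @ gen_pow (gen_b 1) q1 @ gen_pow (gen_b 2) q2"
  have w': "w' \<in> words X" by (simp add: w'_def words_append gen_pow_words a_word_words)
  have p: "ev w' (gen_a i) = p i" if "i \<le> m" for i
    using that s(1) by (cases "i = 0") (auto simp: w'_def conj_eq_def)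
  have "conj_eq m (\<lambda>i. ev v (gen_a i)) (ev v (gen_b 1)) (ev v (gen_b 2))
      (\<lambda>i. ev v (gen_c i) - ev u (gen_c i)) (\<lambda>i. ev w' (gen_a i)) (ev w' (gen_b 1)) (ev w' (gen_b 2))"
    using s(1) by (auto simp: conj_eq_def p) (auto simp: w'_def)
  then have cw: "conjugates w' u v" using c conjugates_iff[OF u v w'] by blast
  \<comment> \<open>Here \<open>K\<close> originates: \<open>m\<close> blocks of a_i and two blocks
    of b_j, each of length at most \<open>B\<close>.\<close>
  have "int (length w') \<le> m * B + B + B"
    using length_a_word[OF s(4)] s(2,3) by (simp add: w'_def)
  also have "\<dots> = int (K * (n + 1) ^ (m + 1))" by (simp add: B_def N_def algebra_simps)
  finally have "length w' \<le> K * (n + 1) ^ (m + 1)" by linarith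
  moreover have "conj_length P S (lift u) (lift v) \<le> length w'"
    unfolding conj_length_lift[OF u v] using w' cw by (intro Least_le) blast
  ultimately show ?thesis by linarith
qed

abbreviation "conj_lengths n \<equiv> {conj_length P S u v | u v.
  u \<in> words S \<and> v \<in> words S \<and> conj_words P u v \<and> length u + length v \<le> n}"

lemma conj_lengths_le:
  assumes "k \<in> conj_lengths n"
  shows "k \<le> K * (n + 1) ^ (m + 1)"
proof -
  obtain U V where k: "k = conj_length P S U V" "U \<in> words S" "V \<in> words S" "conj_words P U V"
    "length U + length V \<le> n" using assms by blast
  moreover obtain u v where uv: "u \<in> words X" "U = lift u" "v \<in> words X" "V = lift v"
    using k(2,3) words_genset by metis
  ultimately have "\<exists>w\<in>words X. conjugates w u v" using conj_words_lift by blast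
  with uv(1,3) show ?thesis unfolding k(1) uv(2,4) by (rule conj_length_le) (use k(5) uv in simp)
qed

text \<open>\<open>Max\<close> is informative only on a finite set; the uniform bound supplies
  finiteness without counting words.\<close>

lemma finite_conj_lengths: "finite (conj_lengths n)"
proof (rule finite_subset)
  show "conj_lengths n \<subseteq> {..K * (n + 1) ^ (m + 1)}"
    by (intro subsetI, unfold atMost_iff, rule conj_lengths_le)
qed simp

lemma conj_length_fun_le: "conj_length_fun P S n \<le> K * (n + 1) ^ (m + 1)"
proof -
  have nil: "[] \<in> words X" "lift [] = []" by (simp_all add: words_Nil lift_def)
  have "conjugates [] [] []" by (simp add: conjugates_def)
  then have "conj_words P [] []" using conj_words_lift[OF nil(1) nil(1)] nil by metis
  then have "conj_lengths n \<noteq> {}" using words_Nil[of S] by fastforce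
  then have "Max (conj_lengths n) \<in> conj_lengths n" by (rule Max_in[OF finite_conj_lengths])
  then show ?thesis unfolding conj_length_fun_def by (rule conj_lengths_le)
qed

section \<open>Lower bound\<close>

lemma conj_length_fun_ge: "n ^ (m + 1) \<le> conj_length_fun P S (6 * n + 6)"
proof -
  define u where "u = gen_pow (gen_b 1) 1 @ gen_pow (gen_b 2) n"
  \<comment> \<open>The last four blocks form a commutator of length 4 n with value c_1^(n^2): this
    is how linear length buys a quadratic right-hand side.\<close>
  define v where "v = u @ gen_pow (gen_b 1) (- int n) @ gen_pow (gen_a 1) (- int n) @
    gen_pow (gen_b 1) n @ gen_pow (gen_a 1) n"
  have u: "u \<in> words X" by (simp add: u_def words_append gen_pow_words)
  have v: "v \<in> words X" using m_pos by (simp add: v_def u words_append gen_pow_words)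
  let ?d = "\<lambda>i. ev v (gen_c i) - ev u (gen_c i)"
  have d: "?d i = (if i = 1 then (int n)\<^sup>2 else 0)" if "1 \<le> i" for i
    using that by (auto simp: v_def u_def ev_append power2_eq_square)
  have ab: "ev u (gen_a i) = 0" "ev v (gen_a i) = 0" "ev v (gen_b i) = ev u (gen_b i)"
    "ev u (gen_b 1) = 1" "ev u (gen_b 2) = n" for i
    by (simp_all add: v_def u_def)
  have c: "conjugates w u v \<longleftrightarrow>
      conj_eq m (\<lambda>i. 0) 1 n ?d (\<lambda>i. ev w (gen_a i)) (ev w (gen_b 1)) (ev w (gen_b 2))"
    if "w \<in> words X" for w
    unfolding conjugates_iff[OF u v that] by (simp add: ab del: One_nat_def)
  \<comment> \<open>The coefficients of n^2 t / (1 - n t). The formula n^(i+1) would give n at index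
    0, where \<open>conj_eq\<close> demands 0.\<close>
  define p where "p = (\<lambda>i. if i = 0 then 0 else int n ^ (i + 1))"
  have w: "a_word m p \<in> words X" by (simp add: a_word_words)
  have wp: "ev (a_word m p) (gen_a i) = p i" if "i \<le> m" for i
    using that by (simp add: p_def)
  have "conjugates (a_word m p) u v"
    unfolding c[OF w] conj_eq_def
  proof (intro conjI ballI)
    fix i assume i: "i \<in> {1..m}"
    then have le: "i \<le> m" "i - 1 \<le> m" by auto
    have "p i - int n * p (i - 1) = ?d i"
      using i
      by (cases i) (auto simp: d p_def power2_eq_square)
    then show "1 * ev (a_word m p) (gen_a i) - int n * ev (a_word m p) (gen_a (i - 1)) -
        (ev (a_word m p) (gen_b 1) * 0 - ev (a_word m p) (gen_b 2) * 0) = ?d i"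
      unfolding wp[OF le(1)] wp[OF le(2)] by simp
  qed simp
  then have ex: "\<exists>w\<in>words X. conjugates w u v" using w by blast
  have "conj_words P (lift u) (lift v)" using conj_words_lift[OF u v] ex by blast
  \<comment> \<open>The exact total is 2 (n + 1) + 4 n, rounded up to the shape C n + C of
    \<open>preceq\<close> with C = 6.\<close>
  moreover have "length (lift u) + length (lift v) \<le> 6 * n + 6" by (simp add: u_def v_def)
  ultimately have "conj_length P S (lift u) (lift v) \<in> conj_lengths (6 * n + 6)"
    using u v words_genset by blast
  then have "conj_length P S (lift u) (lift v) \<le> conj_length_fun P S (6 * n + 6)"
    unfolding conj_length_fun_def using finite_conj_lengths by (intro Max_ge)
  moreover have "n ^ (m + 1) \<le> conj_length P S (lift u) (lift v)"
  proof -
    have "\<exists>w\<in>words X. length w = conj_length P S (lift u) (lift v) \<and> conjugates w u v"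
      unfolding conj_length_lift[OF u v] by (rule LeastI_ex) (use ex in blast)
    then obtain w where w: "w \<in> words X" "length w = conj_length P S (lift u) (lift v)" "conjugates w u v"
      by blast
    note sol = w(3)[unfolded c[OF w(1)]]
    \<comment> \<open>As x = 0, the exponents q have no influence, and y_1 = 1 turns the equations
      into the recursion p_i = n p_(i-1) with p_1 = n^2. Thus every conjugator, not just the one
      constructed above, has these exponents.\<close>
    have "ev w (gen_a (Suc i)) = int n ^ (i + 2)" if "i < m" for i
      using that
    proof (induction i)
      case 0
      then show ?case
        using conj_eqD[OF sol, of 1] d[of 1] ev_a0[OF w(1)] by (simp add: power2_eq_square)
    next
      case (Suc i)
      have "?d (Suc (Suc i)) = 0" using d by simp
      then have "ev w (gen_a (Suc (Suc i))) = int n * ev w (gen_a (Suc i))"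
        using conj_eqD[OF sol, of "Suc (Suc i)"] Suc.prems by simp
      then show ?case using Suc by simp
    qed
    from this[of "m - 1"] have "ev w (gen_a m) = int n ^ (m + 1)" using m_pos by simp
    then have "int (n ^ (m + 1)) \<le> int (length w)" using ev_ab_le(1)[of w m] by simp
    then show ?thesis unfolding w(2) by linarith
  qed
  ultimately show ?thesis by linarith
qed

end

theorem theorem2:
  fixes m :: nat
  assumes "m \<ge> 1"
  shows "conj_length_fun (G_group m) (G_genset m) \<simeq> (\<lambda>n. n ^ (m + 1))"
proof -
  interpret G_presentation m by unfold_locales (rule assms)
  have "conj_length_fun P S n \<le> K * (K * n + K) ^ (m + 1) + K" for n
  proof -
    have "K * (n + 1) ^ (m + 1) \<le> K * (K * n + K) ^ (m + 1)"
      by (intro mult_left_mono power_mono add_mono) auto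
    then show ?thesis using conj_length_fun_le[of n] by linarith
  qed
  moreover have "0 < K" by simp
  ultimately have "conj_length_fun P S \<preceq> (\<lambda>n. n ^ (m + 1))"
    unfolding preceq_def by blast
  moreover have "n ^ (m + 1) \<le> 6 * conj_length_fun P S (6 * n + 6) + 6" for n
    using conj_length_fun_ge[of n] by linarith
  then have "(\<lambda>n. n ^ (m + 1)) \<preceq> conj_length_fun P S"
    unfolding preceq_def by (intro exI[of _ 6]) simp
  ultimately show ?thesis by (simp add: growth_equiv_def)
qed

end
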